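(* For all integers $k \ge 2$ and $m \ge s \ge 1$, $f(km, ks) = f(m, s)$.
   Context: The muffin problem with $m$ muffins and $s$ students (positive integers) asks to cut each of $m$ muffins of size $1$ into finitely many pieces of positive size and to assign every piece to one of $s$ students so that each student receives pieces of total size $m/s$. $f(m,s)$ denotes the maximum, over all such divisions and assignments, of the size of the smallest piece. *)

theory Defs
  imports Complex_Main
begin

text \<open>A division for the muffin problem with m muffins and s students is
  a finite list of pieces (i, j, x): a piece of size x > 0 cut from muffin i < m
  and given to student j < s.  The pieces of each muffin sum to 1 and the pieces
  received by each student sum to m/s.\<close>

definition muffin_division :: "nat \<Rightarrow> nat \<Rightarrow> (nat \<times> nat \<times> real) list \<Rightarrow> bool" where
  "muffin_division m s P \<longleftrightarrow>
     (\<forall>(i, j, x) \<in> set P. i < m \<and> j < s \<and> x > 0) \<and>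
     (\<forall>i < m. sum_list (map (\<lambda>(i', j, x). x) (filter (\<lambda>(i', j, x). i' = i) P)) = 1) \<and>
     (\<forall>j < s. sum_list (map (\<lambda>(i, j', x). x) (filter (\<lambda>(i, j', x). j' = j) P))
                = real m / real s)"

definition smallest_piece :: "(nat \<times> nat \<times> real) list \<Rightarrow> real" where
  "smallest_piece P = Min (set (map (\<lambda>(i, j, x). x) P))"

text \<open>f(m,s): the maximum (supremum; it is attained) of the smallest piece size.\<close>
definition muffin_f :: "nat \<Rightarrow> nat \<Rightarrow> real" where
  "muffin_f m s = Sup {smallest_piece P | P. muffin_division m s P}"

end

theory Submission
  imports Defs
begin

text \<open>Only thresholds \<alpha> between 1/3 and 1/2 are interesting; there every muffin is cut in two.
  Subtracting \<alpha> from each piece leaves a transport problem in which the pieces are merely nonnegative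
  and the size of a student decreases linearly with the number of pieces. Only two consecutive
  numbers of pieces need to occur. If the students with fewer pieces are so large that each of them
  must touch as many muffins as possible, then these students and the muffins form trees, and
  contracting the trees gives a smaller problem of the same shape, with the other students in the
  role of the muffins; solutions can be transferred in both directions. If they are not that large,
  a solution exists: raise \<alpha> until the nonzero masses on each side are equal, if necessary after one
  contraction, and lay them end to end along a segment. All parameters that decide between these cases are
  unchanged when \<open>m\<close> and \<open>s\<close> are multiplied by \<open>k\<close>, so feasibility for \<open>(km, ks)\<close> descends
  to \<open>(m, s)\<close>.\<close>

section \<open>Transport matrices with bounded support\<close>

text \<open>Averaging the blocks of a solution for \<open>(km, ks)\<close> preserves all sums but
  destroys the bounds on the number of nonzero entries. So no solution is folded down: the large one
  only supplies inequalities and its own contraction, while the small one is built from nothing at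
  the bottom of the descent and then expanded. The family \<open>feasible\<close> is as general as
  contraction demands. If each heavy consumer has mass \<open>M1\<close> and touches exactly
  \<open>e + 1\<close> hubs, a tree with \<open>t\<close> of them has \<open>e * t + 1\<close> hubs.
  Its leftover mass is \<open>(e * t + 1) * h - t * M1 = h - t * (M1 - e * h)\<close>, its leftover
  degree \<open>(e * t + 1) * D - t * (e + 1) = D + t * (e * D - (e + 1))\<close>. Both are affine
  in \<open>t\<close>: a tree is a consumer whose type is the number of heavy consumers in it, with
  \<open>M1 - e * h\<close> and \<open>e * D - (e + 1)\<close> as the new \<open>\<kappa>\<close>
  and \<open>\<eta>\<close>. As to the range of thresholds: 1/3 is always attainable when there are
  at least as many muffins as students, and above 1/2 no muffin can be cut at all.\<close>

definition transport ::
  "'a set \<Rightarrow> ('a \<Rightarrow> real) \<Rightarrow> ('a \<Rightarrow> nat) \<Rightarrow> 'b set \<Rightarrow> ('b \<Rightarrow> real) \<Rightarrow> ('b \<Rightarrow> nat) \<Rightarrow> ('a \<Rightarrow> 'b \<Rightarrow> real) \<Rightarrow> bool"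
  where "transport I \<mu> d J \<nu> e y \<longleftrightarrow>
    (\<forall>i\<in>I. \<forall>j\<in>J. 0 \<le> y i j) \<and>
    (\<forall>i\<in>I. (\<Sum>j\<in>J. y i j) = \<mu> i \<and> card {j \<in> J. y i j \<noteq> 0} \<le> d i) \<and>
    (\<forall>j\<in>J. (\<Sum>i\<in>I. y i j) = \<nu> j \<and> card {i \<in> I. y i j \<noteq> 0} \<le> e j)"

text \<open>There are \<open>a\<close> hubs of mass \<open>h\<close> and \<open>N\<close> consumers; a consumer of type \<open>t\<close> has mass
  \<open>M - t \<kappa>\<close> and accepts \<open>A + t \<eta>\<close> pieces. The muffin problem with threshold \<open>\<alpha>\<close> is the case
  \<open>h = 1 - 2 \<alpha>\<close>, \<open>D = 2\<close>, \<open>M = m / s\<close>, \<open>\<kappa> = \<alpha>\<close>, \<open>A = 0\<close>, \<open>\<eta> = 1\<close>, the type of a student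
  being the number of pieces.\<close>
definition feasible ::
  "nat \<Rightarrow> real \<Rightarrow> nat \<Rightarrow> nat \<Rightarrow> nat \<Rightarrow> real \<Rightarrow> real \<Rightarrow> nat \<Rightarrow> nat \<Rightarrow> bool"
  where "feasible a h D N R M \<kappa> A \<eta> \<longleftrightarrow>
    (\<exists>\<tau> y. (\<Sum>j<N. \<tau> j) = R \<and>
       transport {..<a} (\<lambda>_. h) (\<lambda>_. D) {..<N} (\<lambda>j. M - real (\<tau> j) * \<kappa>) (\<lambda>j. A + \<tau> j * \<eta>) y)"

lemma transport_reindex:
  assumes f: "bij_betw f I I'" and g: "bij_betw g J J'"
    and t: "transport I' \<mu> d J' \<nu> e y"
  shows "transport I (\<lambda>i. \<mu> (f i)) (\<lambda>i. d (f i)) J (\<lambda>j. \<nu> (g j)) (\<lambda>j. e (g j)) (\<lambda>i j. y (f i) (g j))"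
proof -
  have fI: "f i \<in> I'" if "i \<in> I" for i using that f by (auto simp: bij_betw_def)
  have gJ: "g j \<in> J'" if "j \<in> J" for j using that g by (auto simp: bij_betw_def)
  have s1: "(\<Sum>j\<in>J. y i (g j)) = (\<Sum>j\<in>J'. y i j)" for i
    using sum.reindex_bij_betw[OF g] by simp
  have s2: "(\<Sum>i\<in>I. y (f i) j) = (\<Sum>i\<in>I'. y i j)" for j
    using sum.reindex_bij_betw[OF f, of "\<lambda>i. y i j"] by simp
  have c: "card {x \<in> X. P (k x)} = card {x \<in> X'. P x}" if "bij_betw k X X'"
    for k :: "'x \<Rightarrow> 'y" and X X' P
  proof -
    have "bij_betw k {x \<in> X. P (k x)} {x \<in> X'. P x}"
      using that by (auto simp: bij_betw_def inj_on_def)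
    then show ?thesis by (rule bij_betw_same_card)
  qed
  show ?thesis
    using t fI gJ unfolding transport_def
    by (simp add: s1 s2 c[OF g, of "\<lambda>j. y _ j \<noteq> 0"] c[OF f, of "\<lambda>i. y i _ \<noteq> 0"])
qed

lemma transport_cong:
  assumes "\<And>i. i \<in> I \<Longrightarrow> \<mu> i = \<mu>' i" "\<And>i. i \<in> I \<Longrightarrow> d i \<le> d' i"
    "\<And>j. j \<in> J \<Longrightarrow> \<nu> j = \<nu>' j" "\<And>j. j \<in> J \<Longrightarrow> e j \<le> e' j"
    "transport I \<mu> d J \<nu> e y"
  shows "transport I \<mu>' d' J \<nu>' e' y"
  using assms unfolding transport_def by (auto intro: order_trans)

lemma feasibleI:
  assumes "finite I" "finite J" "card I = a" "card J = N" "(\<Sum>j\<in>J. \<tau> j) = R"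
    "transport I (\<lambda>_. h) (\<lambda>_. D) J (\<lambda>j. M - real (\<tau> j) * \<kappa>) (\<lambda>j. A + \<tau> j * \<eta>) y"
  shows "feasible a h D N R M \<kappa> A \<eta>"
proof -
  obtain f where f: "bij_betw f {..<a} I"
    using ex_bij_betw_nat_finite[OF assms(1)] assms(3) by (auto simp: atLeast0LessThan)
  obtain g where g: "bij_betw g {..<N} J"
    using ex_bij_betw_nat_finite[OF assms(2)] assms(4) by (auto simp: atLeast0LessThan)
  have "(\<Sum>j<N. \<tau> (g j)) = R"
    using sum.reindex_bij_betw[OF g, of \<tau>] assms(5) by simp
  then show ?thesis
    using transport_reindex[OF f g assms(6)] unfolding feasible_def by blast
qed

section \<open>Completing supports to exact degrees\<close>

lemma nat_matrix_with_margins: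
  fixes r :: "'a \<Rightarrow> nat" and c :: "'b \<Rightarrow> nat"
  assumes "finite I" "finite J" "sum r I = sum c J"
  shows "\<exists>n. (\<forall>i\<in>I. (\<Sum>j\<in>J. n i j) = r i) \<and> (\<forall>j\<in>J. (\<Sum>i\<in>I. n i j) = c j)"
  using assms
proof (induction "sum r I" arbitrary: r c)
  case 0
  then have "\<forall>i\<in>I. r i = 0" "\<forall>j\<in>J. c j = 0" by auto
  then show ?case by (intro exI[of _ "\<lambda>_ _. 0"]) auto
next
  case (Suc x)
  then obtain i0 where i0: "i0 \<in> I" "r i0 > 0" by (metis nat.distinct(1) neq0_conv sum.neutral)
  from Suc obtain j0 where j0: "j0 \<in> J" "c j0 > 0" by (metis nat.distinct(1) neq0_conv sum.neutral)
  define r' where "r' = r(i0 := r i0 - 1)"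
  define c' where "c' = c(j0 := c j0 - 1)"
  have dec: "sum (f(x0 := f x0 - 1)) X + 1 = sum f X" if "finite X" "x0 \<in> X" "f x0 > 0"
    for f :: "'x \<Rightarrow> nat" and X x0
  proof -
    have "sum (f(x0 := f x0 - 1)) X = (f x0 - 1) + sum f (X - {x0})"
      using that by (simp add: sum.remove[of X x0])
    moreover have "sum f X = f x0 + sum f (X - {x0})"
      using that by (simp add: sum.remove)
    ultimately show ?thesis using that by simp
  qed
  have a: "sum r' I + 1 = sum r I" "sum c' J + 1 = sum c J"
    using dec[of I i0 r] dec[of J j0 c] i0 j0 Suc.prems by (auto simp: r'_def c'_def)
  then obtain n where n: "\<forall>i\<in>I. (\<Sum>j\<in>J. n i j) = r' i" "\<forall>j\<in>J. (\<Sum>i\<in>I. n i j) = c' j"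
    using Suc.hyps(1)[of r' c'] Suc.hyps(2) Suc.prems by auto
  define n' where "n' = (\<lambda>i j. n i j + (if i = i0 \<and> j = j0 then 1 else 0))"
  have "(\<Sum>j\<in>J. n' i j) = r i" if "i \<in> I" for i
  proof -
    have "(\<Sum>j\<in>J. n' i j) = (\<Sum>j\<in>J. n i j) + (if i = i0 then 1 else 0)"
      using j0 Suc.prems by (auto simp: n'_def sum.distrib)
    then show ?thesis using n(1) that i0 by (auto simp: r'_def)
  qed
  moreover have "(\<Sum>i\<in>I. n' i j) = c j" if "j \<in> J" for j
  proof -
    have "(\<Sum>i\<in>I. n' i j) = (\<Sum>i\<in>I. n i j) + (if j = j0 then 1 else 0)"
      using i0 Suc.prems by (auto simp: n'_def sum.distrib)
    then show ?thesis using n(2) that j0 by (auto simp: c'_def)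
  qed
  ultimately show ?case by blast
qed

lemma transport_multiplicities:
  assumes fin: "finite I" "finite J" and t: "transport I \<mu> d J \<nu> e y" and de: "sum d I = sum e J"
  shows "\<exists>n::'a \<Rightarrow> 'b \<Rightarrow> nat. (\<forall>i\<in>I. (\<Sum>j\<in>J. n i j) = d i) \<and> (\<forall>j\<in>J. (\<Sum>i\<in>I. n i j) = e j) \<and>
    (\<forall>i\<in>I. \<forall>j\<in>J. y i j \<noteq> 0 \<longrightarrow> n i j \<noteq> 0)"
proof -
  define b :: "'a \<Rightarrow> 'b \<Rightarrow> nat" where "b = (\<lambda>i j. of_bool (y i j \<noteq> 0))"
  have r: "(\<Sum>j\<in>J. b i j) = card {j \<in> J. y i j \<noteq> 0}" for i
    using fin by (simp add: b_def sum.If_cases Int_def)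
  have c: "(\<Sum>i\<in>I. b i j) = card {i \<in> I. y i j \<noteq> 0}" for j
    using fin by (simp add: b_def sum.If_cases Int_def)
  have rd: "(\<Sum>j\<in>J. b i j) \<le> d i" if "i \<in> I" for i using t that unfolding r transport_def by auto
  have ce: "(\<Sum>i\<in>I. b i j) \<le> e j" if "j \<in> J" for j using t that unfolding c transport_def by auto
  have "(\<Sum>i\<in>I. d i - (\<Sum>j\<in>J. b i j)) + (\<Sum>i\<in>I. \<Sum>j\<in>J. b i j) = sum d I"
    using rd by (subst sum.distrib[symmetric]) (auto intro: sum.cong)
  moreover have "(\<Sum>j\<in>J. e j - (\<Sum>i\<in>I. b i j)) + (\<Sum>j\<in>J. \<Sum>i\<in>I. b i j) = sum e J"
    using ce by (subst sum.distrib[symmetric]) (auto intro: sum.cong)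
  moreover have "(\<Sum>i\<in>I. \<Sum>j\<in>J. b i j) = (\<Sum>j\<in>J. \<Sum>i\<in>I. b i j)" by (rule sum.swap)
  ultimately have "(\<Sum>i\<in>I. d i - (\<Sum>j\<in>J. b i j)) = (\<Sum>j\<in>J. e j - (\<Sum>i\<in>I. b i j))"
    using de by linarith
  from nat_matrix_with_margins[OF fin this] obtain n where
    n: "\<forall>i\<in>I. (\<Sum>j\<in>J. n i j) = d i - (\<Sum>j\<in>J. b i j)"
       "\<forall>j\<in>J. (\<Sum>i\<in>I. n i j) = e j - (\<Sum>i\<in>I. b i j)" by blast
  show ?thesis
  proof (intro exI[of _ "\<lambda>i j. n i j + b i j"] conjI ballI impI)
    fix i j assume "i \<in> I" "j \<in> J" "y i j \<noteq> 0"
    then show "n i j + b i j \<noteq> 0" by (simp add: b_def)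
  qed (use n rd ce in \<open>auto simp: sum.distrib\<close>)
qed

text \<open>Adding \<open>t\<close> along every edge of the completed multigraph turns exact degrees
  into mass. Every nonzero entry of \<open>y\<close> lies on an edge, so the support bounds
  survive.\<close>

lemma transport_shift:
  assumes fin: "finite I" "finite J" and de: "sum d I = sum e J" and t0: "0 \<le> t"
    and t: "transport I (\<lambda>i. \<mu> i - t * d i) d J (\<lambda>j. \<nu> j - t * e j) e y"
  shows "\<exists>y. transport I \<mu> d J \<nu> e y"
proof -
  obtain n :: "'a \<Rightarrow> 'b \<Rightarrow> nat" where n: "\<And>i. i\<in>I \<Longrightarrow> (\<Sum>j\<in>J. n i j) = d i"
    "\<And>j. j\<in>J \<Longrightarrow> (\<Sum>i\<in>I. n i j) = e j"
    "\<And>i j. i\<in>I \<Longrightarrow> j\<in>J \<Longrightarrow> y i j \<noteq> 0 \<Longrightarrow> n i j \<noteq> 0"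
    using transport_multiplicities[OF fin t de] by metis
  define z where "z = (\<lambda>i j. y i j + t * n i j)"
  have sup: "card {x \<in> X. w x \<noteq> 0} \<le> sum f X"
    if "finite X" "\<And>x. x \<in> X \<Longrightarrow> w x \<noteq> 0 \<Longrightarrow> f x \<noteq> 0" for X :: "'x set" and w :: "'x \<Rightarrow> real" and f :: "'x \<Rightarrow> nat"
  proof -
    have "card {x \<in> X. w x \<noteq> 0} = (\<Sum>x\<in>X. of_bool (w x \<noteq> 0))"
      using that(1) by (simp add: sum.If_cases Int_def)
    also have "\<dots> \<le> sum f X" using that(2) by (intro sum_mono) (auto simp: Suc_le_eq)
    finally show ?thesis .
  qed
  have "transport I \<mu> d J \<nu> e z"
    unfolding transport_def
  proof (intro conjI ballI)
    fix i j assume "i \<in> I" "j \<in> J" then show "0 \<le> z i j"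
      using t t0 by (auto simp: z_def transport_def)
  next
    fix i assume i: "i \<in> I"
    have "(\<Sum>j\<in>J. z i j) = (\<Sum>j\<in>J. y i j) + t * real (\<Sum>j\<in>J. n i j)"
      by (simp add: z_def sum.distrib sum_distrib_left)
    then show "(\<Sum>j\<in>J. z i j) = \<mu> i" using t i n(1) by (simp add: transport_def)
    have "card {j \<in> J. z i j \<noteq> 0} \<le> (\<Sum>j\<in>J. n i j)"
      using fin n(3)[OF i] by (intro sup) (auto simp: z_def, force)
    then show "card {j \<in> J. z i j \<noteq> 0} \<le> d i" using n(1) i by simp
  next
    fix j assume j: "j \<in> J"
    have "(\<Sum>i\<in>I. z i j) = (\<Sum>i\<in>I. y i j) + t * real (\<Sum>i\<in>I. n i j)"
      by (simp add: z_def sum.distrib sum_distrib_left)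
    then show "(\<Sum>i\<in>I. z i j) = \<nu> j" using t j n(2) by (simp add: transport_def)
    have "card {i \<in> I. z i j \<noteq> 0} \<le> (\<Sum>i\<in>I. n i j)"
      using fin n(3)[OF _ j] by (intro sup) (auto simp: z_def, force)
    then show "card {i \<in> I. z i j \<noteq> 0} \<le> e j" using n(2) j by simp
  qed
  then show ?thesis by blast
qed

text \<open>Subtracting \<open>t\<close> times the degree keeps the mass of a consumer affine in its
  type, now falling at rate \<open>\<kappa> + t * \<eta>\<close>. The equation
  \<open>a * D = N * A + R * \<eta>\<close> is the equality of total degrees.\<close>

lemma feasible_shift:
  assumes "feasible a (h - t * D) D N R (M - t * A) (\<kappa> + t * \<eta>) A \<eta>" "0 \<le> t" "a * D = N * A + R * \<eta>"
  shows "feasible a h D N R M \<kappa> A \<eta>"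
proof -
  obtain \<tau> y where R: "(\<Sum>j<N. \<tau> j) = R" and
    y: "transport {..<a} (\<lambda>_. h - t * D) (\<lambda>_. D) {..<N} (\<lambda>j. M - t * A - real (\<tau> j) * (\<kappa> + t * \<eta>))
      (\<lambda>j. A + \<tau> j * \<eta>) y"
    using assms(1) unfolding feasible_def by blast
  have "transport {..<a} (\<lambda>_. h - t * D) (\<lambda>_. D) {..<N} (\<lambda>j. (M - real (\<tau> j) * \<kappa>) - t * (A + \<tau> j * \<eta>))
      (\<lambda>j. A + \<tau> j * \<eta>) y"
    by (rule transport_cong[OF _ _ _ _ y]) (auto simp: algebra_simps)
  moreover have "(\<Sum>i<a. D) = (\<Sum>j<N. A + \<tau> j * \<eta>)"
    using assms(3) R by (simp add: sum.distrib sum_distrib_right[symmetric])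
  ultimately have "\<exists>y. transport {..<a} (\<lambda>_. h) (\<lambda>_. D) {..<N} (\<lambda>j. M - real (\<tau> j) * \<kappa>) (\<lambda>j. A + \<tau> j * \<eta>) y"
    using assms(2) by (intro transport_shift[of _ _ _ _ t]) auto
  then show ?thesis using R unfolding feasible_def by blast
qed

lemma transport_swap:
  "transport I \<mu> d J \<nu> e y \<Longrightarrow> transport J \<nu> e I \<mu> d (\<lambda>j i. y i j)"
  unfolding transport_def by auto

lemma card_eq_sum_fibres:
  assumes "finite X" "finite B" "g ` X \<subseteq> B"
  shows "(\<Sum>b\<in>B. card {x \<in> X. g x = b}) = card X"
  using sum.group[OF assms, of "\<lambda>_. 1::nat"] by simp

lemma div_eq_iff_interval:
  fixes b x i :: nat
  assumes "b > 0"
  shows "x div b = i \<longleftrightarrow> i * b \<le> x \<and> x < i * b + b"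
  using div_nat_eqI[of b i x] times_div_less_eq_dividend[of b x] dividend_less_times_div[OF assms, of x]
  by (auto simp: mult.commute)

text \<open>Advancing by less than \<open>(D - 1) * a\<close> raises the quotient by at most
  \<open>D - 1\<close>, so a window of length \<open>b\<close> meets at most \<open>D\<close> blocks
  of length \<open>a\<close>.\<close>

lemma card_div_image_le:
  fixes b c D :: nat
  assumes "b \<le> (D - 1) * a" "a > 0" "D > 0" "b > 0"
  shows "card ((\<lambda>x. x div a) ` {i..<i + b}) \<le> D"
proof -
  have "(\<lambda>x. x div a) ` {i..<i + b} \<subseteq> {i div a..<i div a + D}"
  proof (intro image_subsetI)
    fix x assume "x \<in> {i..<i + b}"
    then have x: "i \<le> x" "x < i + (D - 1) * a" using assms(1) by auto
    have "x div a \<le> (i + (D - 1) * a) div a" using x by (intro div_le_mono) auto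
    also have "\<dots> = i div a + (D - 1)" using assms by simp
    also have "\<dots> < i div a + D" using assms(3) by simp
    finally show "x div a \<in> {i div a..<i div a + D}" using div_le_mono[OF x(1)] by auto
  qed
  from card_mono[OF _ this] show ?thesis by simp
qed

text \<open>Lay the masses on both sides end to end along the same segment; an entry is the length of
  the overlap.\<close>
lemma transport_uniform:
  fixes a b D A :: nat and \<theta> :: real
  assumes a: "a > 0" and b: "b > 0" and "\<theta> \<ge> 0" "D > 0" "A > 0" "b \<le> (D - 1) * a" "a \<le> (A - 1) * b"
  shows "\<exists>y. transport {..<a} (\<lambda>_. b * \<theta>) (\<lambda>_. D) {..<b} (\<lambda>_. a * \<theta>) (\<lambda>_. A) y"
proof -
  define X where "X = (\<lambda>i b. {i * b..<i * b + b :: nat})"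
  have X: "{x. x < a' * b' \<and> x div b' = i} = X i b'" if "i < a'" "b' > 0" for i a' b'
  proof -
    have "i * b' + b' \<le> a' * b'" using that by (metis Suc_leI add.commute mult_Suc mult_le_mono1)
    then show ?thesis using that by (auto simp: X_def div_eq_iff_interval)
  qed
  \<comment> \<open>The segment consists of \<open>a * b\<close> cells of length
    \<open>\<theta>\<close>. Hub \<open>i\<close> occupies \<open>b\<close> consecutive cells and
    consumer \<open>j\<close> occupies \<open>a\<close>, so the quotients by \<open>b\<close> and by
    \<open>a\<close> name the two owners of a cell.\<close>
  define y where "y = (\<lambda>i j. \<theta> * card {x. x < a * b \<and> x div b = i \<and> x div a = j})"
  have fin: "finite {x. x < a * b \<and> P x}" for P by simp
  have bj: "x div a < b" "x div b < a" if "x < a * b" for x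
    using that a b by (auto simp: less_mult_imp_div_less mult.commute)
  have main: "(\<Sum>j<b'. card {x. x < a' * b' \<and> x div b' = i \<and> x div a' = j}) = b'"
     "card {j. j < b' \<and> card {x. x < a' * b' \<and> x div b' = i \<and> x div a' = j} \<noteq> 0} \<le> D'"
    if "i < a'" "a' > 0" "b' > 0" "D' > 0" "b' \<le> (D' - 1) * a'" for a' b' i D'
  proof -
    have "x div a' < b'" if "x < a' * b'" for x
      using that by (simp add: less_mult_imp_div_less mult.commute)
    then have "(\<Sum>j<b'. card {x \<in> {x. x < a' * b' \<and> x div b' = i}. x div a' = j}) = card {x. x < a' * b' \<and> x div b' = i}"
      by (intro card_eq_sum_fibres) auto
    also have "\<dots> = b'" using X[OF that(1,3)] by (simp add: X_def)
    finally show "(\<Sum>j<b'. card {x. x < a' * b' \<and> x div b' = i \<and> x div a' = j}) = b'"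
      by (simp add: conj_assoc)
    have "{j. j < b' \<and> card {x. x < a' * b' \<and> x div b' = i \<and> x div a' = j} \<noteq> 0} \<subseteq> (\<lambda>x. x div a') ` X i b'"
      unfolding X[OF that(1,3), symmetric] by (auto simp: card_gt_0_iff)
    then have "card {j. j < b' \<and> card {x. x < a' * b' \<and> x div b' = i \<and> x div a' = j} \<noteq> 0}
        \<le> card ((\<lambda>x. x div a') ` X i b')"
      by (intro card_mono) (auto simp: X_def)
    also have "\<dots> \<le> D'" unfolding X_def using that by (intro card_div_image_le) auto
    finally show "card {j. j < b' \<and> card {x. x < a' * b' \<and> x div b' = i \<and> x div a' = j} \<noteq> 0} \<le> D'" .
  qed
  have z: "y i j \<noteq> 0 \<longleftrightarrow> \<theta> \<noteq> 0 \<and> card {x. x < a * b \<and> x div b = i \<and> x div a = j} \<noteq> 0" for i j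
    by (simp add: y_def)
  have "transport {..<a} (\<lambda>_. b * \<theta>) (\<lambda>_. D) {..<b} (\<lambda>_. a * \<theta>) (\<lambda>_. A) y"
    unfolding transport_def
  proof (intro conjI ballI)
    fix i assume "i \<in> {..<a}"
    then have m: "(\<Sum>j<b. card {x. x < a * b \<and> x div b = i \<and> x div a = j}) = b"
       "card {j. j < b \<and> card {x. x < a * b \<and> x div b = i \<and> x div a = j} \<noteq> 0} \<le> D"
      using main[of i a b D] assms by auto
    show "(\<Sum>j<b. y i j) = b * \<theta>"
      unfolding y_def sum_distrib_left[symmetric] of_nat_sum[symmetric] m(1) by simp
    show "card {j \<in> {..<b}. y i j \<noteq> 0} \<le> D"
      by (rule order_trans[OF card_mono m(2)]) (auto simp: z)
  next
    fix j assume "j \<in> {..<b}"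
    then have m: "(\<Sum>i<a. card {x. x < a * b \<and> x div b = i \<and> x div a = j}) = a"
       "card {i. i < a \<and> card {x. x < a * b \<and> x div b = i \<and> x div a = j} \<noteq> 0} \<le> A"
      using main[of j b a A] assms by (auto simp: mult.commute conj_commute)
    show "(\<Sum>i<a. y i j) = a * \<theta>"
      unfolding y_def sum_distrib_left[symmetric] of_nat_sum[symmetric] m(1) by simp
    show "card {i \<in> {..<a}. y i j \<noteq> 0} \<le> A"
      by (rule order_trans[OF card_mono m(2)]) (auto simp: z)
  qed (use assms in \<open>auto simp: y_def\<close>)
  then show ?thesis by blast
qed

section \<open>Expanding and contracting trees\<close>

text \<open>Row \<open>i\<close> is a tree with \<open>t i\<close> heavy consumers still to be split off; \<open>n\<close> of them already are
  columns of their own.\<close>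
definition partial_expansion ::
  "nat \<Rightarrow> real \<Rightarrow> nat \<Rightarrow> real \<Rightarrow> nat \<Rightarrow> real \<Rightarrow> nat \<Rightarrow> nat \<Rightarrow> nat \<Rightarrow> nat \<Rightarrow> nat \<Rightarrow> bool"
  where "partial_expansion e h D \<kappa> \<eta> M A q p n T \<longleftrightarrow>
    (\<exists>t y. (\<Sum>i<p. t i) = T \<and>
      transport {..<p} (\<lambda>i. h - real (t i) * \<kappa>) (\<lambda>i. D + t i * \<eta>)
        {..<q + n} (\<lambda>j. if j < q then M else \<kappa> + e * h) (\<lambda>j. if j < q then A else e + 1) y)"

text \<open>Serves to spread entries over \<open>e\<close> new hubs with at most \<open>c\<close> on
  each: number the set and divide the numbers by \<open>c\<close>.\<close>

lemma partition_small_fibres: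
  fixes e c :: nat
  assumes "finite S" "card S \<le> e * c"
  shows "\<exists>\<gamma>. (\<forall>s\<in>S. \<gamma> s < e) \<and> (\<forall>l. card {s \<in> S. \<gamma> s = l} \<le> c)"
proof -
  obtain \<phi> where \<phi>: "bij_betw \<phi> S {0..<card S}" using ex_bij_betw_finite_nat[OF assms(1)] by blast
  have lt: "\<phi> s < e * c" if "s \<in> S" for s
  proof -
    have "\<phi> s \<in> {0..<card S}" using \<phi> that by (auto simp: bij_betw_def)
    then show ?thesis using assms(2) by simp
  qed
  show ?thesis
  proof (intro exI[of _ "\<lambda>s. \<phi> s div c"] conjI ballI allI)
    fix s assume "s \<in> S" then show "\<phi> s div c < e" using lt by (simp add: less_mult_imp_div_less)
  next
    fix l
    have "card {s \<in> S. \<phi> s div c = l} \<le> card {l * c..<l * c + c}"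
    proof (rule card_inj_on_le[of \<phi>])
      show "inj_on \<phi> {s \<in> S. \<phi> s div c = l}"
        using \<phi> by (auto simp: bij_betw_def inj_on_def)
      show "\<phi> ` {s \<in> S. \<phi> s div c = l} \<subseteq> {l * c..<l * c + c}"
      proof (intro image_subsetI)
        fix s assume s: "s \<in> {s \<in> S. \<phi> s div c = l}"
        then have "c > 0" using lt[of s] by (cases c) auto
        then show "\<phi> s \<in> {l * c..<l * c + c}" using s by (auto simp: div_eq_iff_interval)
      qed
    qed simp
    then show "card {s \<in> S. \<phi> s div c = l} \<le> c" by simp
  qed
qed

text \<open>One heavy consumer, column \<open>v\<close>, is split off from a tree \<open>K\<close>
  together with \<open>e\<close> fresh hubs. Some entries of row \<open>K\<close> move to the fresh
  hubs; the heavy consumer tops each fresh hub up to \<open>h\<close> and gives row \<open>K\<close>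
  what was moved away plus \<open>\<kappa>\<close>. Its mass is then \<open>\<kappa> + e * h\<close>
  however the entries were moved, so only the degrees restrict the choice.\<close>

lemma partial_expansion_step:
  assumes e: "1 \<le> e" and D: "2 \<le> D" and \<kappa>: "0 \<le> \<kappa>" and \<eta>: "\<eta> + (e + 1) = e * D"
    and st: "partial_expansion e h D \<kappa> \<eta> M A q p n (Suc T)"
  shows "partial_expansion e h D \<kappa> \<eta> M A q (p + e) (Suc n) T"
proof -
  define v where "v = q + n"
  obtain t y where T: "(\<Sum>i<p. t i) = Suc T" and
    y: "transport {..<p} (\<lambda>i. h - real (t i) * \<kappa>) (\<lambda>i. D + t i * \<eta>)
        {..<v} (\<lambda>j. if j < q then M else \<kappa> + e * h) (\<lambda>j. if j < q then A else e + 1) y"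
    using st unfolding partial_expansion_def v_def by blast
  have "\<exists>K<p. t K \<noteq> 0"
  proof (rule ccontr)
    assume "\<not> ?thesis" then have "(\<Sum>i<p. t i) = 0" by auto
    with T show False by simp
  qed
  then obtain K j where K: "K < p" "t K = Suc j" by (metis not0_implies_Suc)
  have pos: "0 \<le> y i s" if "i < p" "s < v" for i s using y that by (auto simp: transport_def)
  have rowK: "(\<Sum>s<v. y K s) = h - real (Suc j) * \<kappa>" using y K by (auto simp: transport_def)
  define S where "S = {s \<in> {..<v}. y K s \<noteq> 0}"
  have finS: "finite S" by (simp add: S_def)
  have cS: "card S \<le> D + Suc j * \<eta>" using y K unfolding S_def transport_def by (metis lessThan_iff)
  \<comment> \<open>Each fresh hub keeps one of its \<open>D\<close> places for the heavy consumer,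
    so the \<open>e\<close> hubs together absorb at most \<open>e * (D - 1)\<close> entries.\<close>
  define c where "c = min (card S) (e * (D - 1))"
  obtain S' where S': "S' \<subseteq> S" "card S' = c"
    using obtain_subset_with_card_n[of c S] by (auto simp: c_def)
  have finS': "finite S'" using S' finS finite_subset by blast
  have S'v: "s < v" if "s \<in> S'" for s using that S' by (auto simp: S_def)
  obtain \<gamma> where \<gamma>: "\<And>s. s \<in> S' \<Longrightarrow> \<gamma> s < e" "\<And>l. card {s \<in> S'. \<gamma> s = l} \<le> D - 1"
    using partition_small_fibres[OF finS', of e "D - 1"] S'(2) by (auto simp: c_def)
  define P where "P = (\<lambda>l. \<Sum>s\<in>{s \<in> S'. \<gamma> s = l}. y K s)"
  have Ppos: "0 \<le> P l" for l unfolding P_def using pos K S'v by (intro sum_nonneg) auto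
  have Psum: "(\<Sum>l<e. P l) = (\<Sum>s\<in>S'. y K s)"
    unfolding P_def using \<gamma>(1) finS' by (intro sum.group) auto
  have Sle: "(\<Sum>s\<in>S'. y K s) \<le> h"
  proof -
    have "(\<Sum>s\<in>S'. y K s) \<le> (\<Sum>s<v. y K s)"
      using pos K S'v by (intro sum_mono2) auto
    also have "\<dots> \<le> h" using rowK \<kappa> by simp
    finally show ?thesis .
  qed
  have Ple: "P l \<le> h" for l
  proof -
    have "P l \<le> (\<Sum>s\<in>S'. y K s)"
      unfolding P_def using pos K S'v finS' by (intro sum_mono2) auto
    with Sle show ?thesis by simp
  qed
  define z where "z = (\<lambda>i s. if s = v then (if i = K then \<kappa> + (\<Sum>s\<in>S'. y K s) else if p \<le> i then h - P (i - p) else 0)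
     else if i = K then (if s \<in> S' then 0 else y K s)
     else if p \<le> i then (if s \<in> S' \<and> \<gamma> s = i - p then y K s else 0) else y i s)"
  define t' where "t' = (\<lambda>i. if i = K then j else if p \<le> i then 0 else t i)"
  have Kp: "K \<noteq> p + l" for l using K by simp
  have "(\<Sum>i<p + e. t' i) = (\<Sum>i<p. t' i)"
    using K by (intro sum.mono_neutral_right) (auto simp: t'_def)
  moreover have "(\<Sum>i<p. t' i) + 1 = (\<Sum>i<p. t i)"
  proof -
    have "(\<Sum>i<p. t' i) = t' K + (\<Sum>i\<in>{..<p} - {K}. t' i)" using K by (intro sum.remove) auto
    also have "(\<Sum>i\<in>{..<p} - {K}. t' i) = (\<Sum>i\<in>{..<p} - {K}. t i)"
      by (intro sum.cong) (auto simp: t'_def)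
    finally have "(\<Sum>i<p. t' i) = j + (\<Sum>i\<in>{..<p} - {K}. t i)" by (simp add: t'_def)
    moreover have "(\<Sum>i<p. t i) = t K + (\<Sum>i\<in>{..<p} - {K}. t i)" using K by (intro sum.remove) auto
    ultimately show ?thesis using K by simp
  qed
  ultimately have T': "(\<Sum>i<p + e. t' i) = T" using T by simp
  have spl: "(\<Sum>i<p + e'. f i) = (\<Sum>i<p. f i) + (\<Sum>l<e'. f (p + l))" for f :: "nat \<Rightarrow> real" and e'
    by (induction e') simp_all
  have "transport {..<p + e} (\<lambda>i. h - real (t' i) * \<kappa>) (\<lambda>i. D + t' i * \<eta>)
        {..<Suc v} (\<lambda>j. if j < q then M else \<kappa> + e * h) (\<lambda>j. if j < q then A else e + 1) z"
    unfolding transport_def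
  proof (intro conjI ballI)
    fix i s assume "i \<in> {..<p + e}" "s \<in> {..<Suc v}"
    then show "0 \<le> z i s"
      using pos K \<kappa> Ple Ppos S'v by (auto simp: z_def intro!: add_nonneg_nonneg sum_nonneg)
  next
    fix i assume i: "i \<in> {..<p + e}"
    have "(\<Sum>s<v. z i s) + z i v = h - real (t' i) * \<kappa> \<and>
      card {s \<in> {..<Suc v}. z i s \<noteq> 0} \<le> D + t' i * \<eta>"
    proof (cases "i = K")
      case True
      have "(\<Sum>s<v. z i s) = (\<Sum>s\<in>{..<v} - S'. y K s)"
        using True by (intro sum.mono_neutral_cong_right) (auto simp: z_def)
      also have "\<dots> = (\<Sum>s<v. y K s) - (\<Sum>s\<in>S'. y K s)"
        using S'v by (intro sum_diff) auto
      finally have 1: "(\<Sum>s<v. z i s) + z i v = h - real (t' i) * \<kappa>"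
        using True rowK by (simp add: z_def t'_def algebra_simps)
      have "{s \<in> {..<Suc v}. z i s \<noteq> 0} \<subseteq> insert v (S - S')"
        using True by (auto simp: z_def S_def split: if_splits)
      then have "card {s \<in> {..<Suc v}. z i s \<noteq> 0} \<le> card (insert v (S - S'))"
        using finS by (intro card_mono) auto
      also have "\<dots> \<le> Suc (card (S - S'))" by (rule card_insert_le_m1) auto
      also have "card (S - S') = card S - c" using S' finS' by (simp add: card_Diff_subset)
      also have "Suc (card S - c) \<le> D + j * \<eta>"
      proof -
        \<comment> \<open>Row \<open>K\<close> loses \<open>\<eta> + 1\<close> entries and gains the
          one for \<open>v\<close>, which matches the drop of its bound when its type falls by one.
          If everything has moved, the single entry fits anyway.\<close>
        have "e * (D - 1) = \<eta> + 1" using \<eta> e D by (simp add: algebra_simps diff_mult_distrib2)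
        then show ?thesis using cS D unfolding c_def by (auto simp: min_def)
      qed
      finally show ?thesis using 1 True by (simp add: t'_def)
    next
      case iK: False
      show ?thesis
      proof (cases "p \<le> i")
        case True
        define l where "l = i - p"
        have "(\<Sum>s<v. z i s) = P l"
          unfolding P_def using True iK S'v by (intro sum.mono_neutral_cong_right) (auto simp: z_def l_def)
        then have 1: "(\<Sum>s<v. z i s) + z i v = h - real (t' i) * \<kappa>"
          using True iK by (simp add: z_def t'_def l_def)
        have "{s \<in> {..<Suc v}. z i s \<noteq> 0} \<subseteq> insert v {s \<in> S'. \<gamma> s = l}"
          using True iK by (auto simp: z_def l_def split: if_splits)
        then have "card {s \<in> {..<Suc v}. z i s \<noteq> 0} \<le> card (insert v {s \<in> S'. \<gamma> s = l})"
          using finS' by (intro card_mono) auto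
        also have "\<dots> \<le> Suc (card {s \<in> S'. \<gamma> s = l})" by (rule card_insert_le_m1) auto
        also have "\<dots> \<le> D" using \<gamma>(2)[of l] D by simp
        finally show ?thesis using 1 by simp
      next
        case False
        have zi: "z i s = y i s" if "s < v" for s using False iK that by (auto simp: z_def)
        have zv: "z i v = 0" using False iK by (auto simp: z_def)
        have "{s \<in> {..<Suc v}. z i s \<noteq> 0} = {s \<in> {..<v}. y i s \<noteq> 0}"
          using zi zv by (auto simp: less_Suc_eq)
        then show ?thesis using y False iK zi zv by (auto simp: transport_def t'_def)
      qed
    qed
    then show "(\<Sum>s<Suc v. z i s) = h - real (t' i) * \<kappa>"
      and "card {s \<in> {..<Suc v}. z i s \<noteq> 0} \<le> D + t' i * \<eta>" by auto
  next
    fix s assume s: "s \<in> {..<Suc v}"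
    have "(\<Sum>i<p + e. z i s) = (if s < q then M else \<kappa> + e * h) \<and>
      card {i \<in> {..<p + e}. z i s \<noteq> 0} \<le> (if s < q then A else e + 1)"
    proof (cases "s = v")
      case True
      have "(\<Sum>i<p. z i v) = (\<Sum>i\<in>{K}. \<kappa> + (\<Sum>s\<in>S'. y K s))"
        using K by (intro sum.mono_neutral_cong_right) (auto simp: z_def)
      moreover have "(\<Sum>l<e. z (p + l) v) = e * h - (\<Sum>s\<in>S'. y K s)"
        using Kp[symmetric] Psum by (simp add: z_def sum_subtractf)
      ultimately have 1: "(\<Sum>i<p + e. z i s) = \<kappa> + e * h" using True by (simp add: spl)
      have "{i \<in> {..<p + e}. z i s \<noteq> 0} \<subseteq> insert K {p..<p + e}"
        using True by (auto simp: z_def split: if_splits)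
      then have "card {i \<in> {..<p + e}. z i s \<noteq> 0} \<le> card (insert K {p..<p + e})"
        by (intro card_mono) auto
      also have "\<dots> \<le> e + 1" by (rule order_trans[OF card_insert_le_m1]) auto
      finally show ?thesis using 1 True by (simp add: v_def)
    next
      case sv: False
      then have s: "s < v" using s by simp
      have ys: "(\<Sum>i<p. y i s) = (if s < q then M else \<kappa> + e * h)"
        "card {i \<in> {..<p}. y i s \<noteq> 0} \<le> (if s < q then A else e + 1)"
        using y s unfolding transport_def by auto
      show ?thesis
      proof (cases "s \<in> S'")
        case True
        have "(\<Sum>i<p. z i s) = (\<Sum>i\<in>{..<p} - {K}. y i s)"
          using True sv by (intro sum.mono_neutral_cong_right) (auto simp: z_def)
        also have "\<dots> = (\<Sum>i<p. y i s) - y K s" using K by (simp add: sum_diff1)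
        finally have 1: "(\<Sum>i<p. z i s) = (\<Sum>i<p. y i s) - y K s" .
        have "(\<Sum>l<e. z (p + l) s) = (\<Sum>l\<in>{\<gamma> s}. y K s)"
          using True sv Kp \<gamma>(1) by (intro sum.mono_neutral_cong_right) (auto simp: z_def)
        then have 2: "(\<Sum>i<p + e. z i s) = (\<Sum>i<p. y i s)" using 1 by (simp add: spl)
        have KS: "K \<in> {i \<in> {..<p}. y i s \<noteq> 0}" using True S' K by (auto simp: S_def)
        \<comment> \<open>For a moved entry the fresh hub merely replaces \<open>K\<close>, so the
          number of hubs at column \<open>s\<close> does not grow.\<close>
        have "{i \<in> {..<p + e}. z i s \<noteq> 0} \<subseteq> insert (p + \<gamma> s) ({i \<in> {..<p}. y i s \<noteq> 0} - {K})"
          using True sv by (auto simp: z_def split: if_splits)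
        then have "card {i \<in> {..<p + e}. z i s \<noteq> 0} \<le> card (insert (p + \<gamma> s) ({i \<in> {..<p}. y i s \<noteq> 0} - {K}))"
          by (intro card_mono) auto
        also have "\<dots> \<le> Suc (card ({i \<in> {..<p}. y i s \<noteq> 0} - {K}))" by (rule card_insert_le_m1) auto
        also have "\<dots> = card {i \<in> {..<p}. y i s \<noteq> 0}"
          using KS by (intro card_Suc_Diff1) auto
        finally show ?thesis using 2 ys by simp
      next
        case False
        have "(\<Sum>i<p. z i s) = (\<Sum>i<p. y i s)"
          using False sv by (intro sum.cong) (auto simp: z_def)
        moreover have "(\<Sum>l<e. z (p + l) s) = 0"
          using False sv Kp by (intro sum.neutral) (auto simp: z_def)
        moreover have "{i \<in> {..<p + e}. z i s \<noteq> 0} \<subseteq> {i \<in> {..<p}. y i s \<noteq> 0}"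
          using False sv K by (auto simp: z_def split: if_splits)
        then have "card {i \<in> {..<p + e}. z i s \<noteq> 0} \<le> card {i \<in> {..<p}. y i s \<noteq> 0}"
          by (intro card_mono) auto
        ultimately show ?thesis using ys by (simp add: spl)
      qed
    qed
    then show "(\<Sum>i<p + e. z i s) = (if s < q then M else \<kappa> + e * h)"
      and "card {i \<in> {..<p + e}. z i s \<noteq> 0} \<le> (if s < q then A else e + 1)" by auto
  qed
  then show ?thesis using T' unfolding partial_expansion_def v_def by (metis add_Suc_right)
qed

lemma partial_expansion_complete:
  assumes "1 \<le> e" "2 \<le> D" "0 \<le> \<kappa>" "\<eta> + (e + 1) = e * D"
    and "partial_expansion e h D \<kappa> \<eta> M A q p n T"
  shows "partial_expansion e h D \<kappa> \<eta> M A q (p + T * e) (n + T) 0"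
  using assms(5)
proof (induction T arbitrary: p n)
  case (Suc T)
  from Suc.IH[OF partial_expansion_step[OF assms(1-4) Suc.prems]] show ?case
    by (simp add: add.assoc)
qed simp

text \<open>Read the contracted problem with trees as rows and the consumers of type
  \<open>r + 1\<close> as columns. Splitting off all \<open>N1\<close> heavy consumers leaves trees
  of type 0, which are ordinary hubs. Each split adds \<open>e\<close> hubs, whence
  \<open>a = N' + N1 * e\<close>, and produces a consumer of mass \<open>\<kappa>' + e * h\<close>,
  the mass of type \<open>r\<close>.\<close>

lemma feasible_expand:
  fixes e :: nat and h M M2 \<kappa> \<kappa>' :: real
  assumes f: "feasible N2 M2 A2 N' N1 h \<kappa>' D \<eta>'" and "0 \<le> \<kappa>'" "1 \<le> e" "2 \<le> D" "\<eta>' + (e + 1) = e * D"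
    and a: "a = N' + N1 * e" and N: "N = N2 + N1" and R: "R = N2 * (r + 1) + N1 * r"
    and M: "M - real r * \<kappa> = \<kappa>' + e * h" and M2: "M2 = M - real (r + 1) * \<kappa>"
    and A: "A + r * \<eta> = e + 1" and A2: "A2 = A + (r + 1) * \<eta>"
  shows "feasible a h D N R M \<kappa> A \<eta>"
proof -
  obtain \<tau>' y' where \<tau>': "(\<Sum>i<N'. \<tau>' i) = N1" and y':
    "transport {..<N2} (\<lambda>_. M2) (\<lambda>_. A2) {..<N'} (\<lambda>j. h - real (\<tau>' j) * \<kappa>') (\<lambda>j. D + \<tau>' j * \<eta>') y'"
    using f unfolding feasible_def by blast
  have "transport {..<N'} (\<lambda>j. h - real (\<tau>' j) * \<kappa>') (\<lambda>j. D + \<tau>' j * \<eta>')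
      {..<N2 + 0} (\<lambda>j. if j < N2 then M2 else \<kappa>' + e * h) (\<lambda>j. if j < N2 then A2 else e + 1) (\<lambda>j i. y' i j)"
    by (simp, rule transport_cong[OF _ _ _ _ transport_swap[OF y']]) auto
  then have "partial_expansion e h D \<kappa>' \<eta>' M2 A2 N2 N' 0 N1"
    using \<tau>' unfolding partial_expansion_def by blast
  from partial_expansion_complete[OF assms(3,4,2,5) this]
  obtain t y where t: "(\<Sum>i<a. t i) = 0" and
    y: "transport {..<a} (\<lambda>i. h - real (t i) * \<kappa>') (\<lambda>i. D + t i * \<eta>')
        {..<N} (\<lambda>j. if j < N2 then M2 else \<kappa>' + e * h) (\<lambda>j. if j < N2 then A2 else e + 1) y"
    unfolding partial_expansion_def a N by auto
  define \<tau> where "\<tau> = (\<lambda>j. if j < N2 then r + 1 else r)"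
  have "(\<Sum>j<N. \<tau> j) = R"
    unfolding N R by (simp add: \<tau>_def lessThan_atLeast0 sum.atLeastLessThan_concat[symmetric, of 0 N2 "N2 + N1"])
  moreover have "transport {..<a} (\<lambda>_. h) (\<lambda>_. D) {..<N} (\<lambda>j. M - real (\<tau> j) * \<kappa>) (\<lambda>j. A + \<tau> j * \<eta>) y"
    by (rule transport_cong[OF _ _ _ _ y]) (use t M M2 A A2 in \<open>auto simp: \<tau>_def\<close>)
  ultimately show ?thesis unfolding feasible_def by blast
qed

text \<open>Add the hyperedges one at a time. Each fuses the components that it meets, at most
  \<open>e + 1\<close> in number. If these have at most \<open>e * x + 1\<close> vertices each,
  \<open>x\<close> being the number of their hyperedges, the fused component has at most
  \<open>e * X + (e + 1) = e * (X + 1) + 1\<close>, where \<open>X\<close> is the sum of the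
  \<open>x\<close>.\<close>

lemma hyperedge_components:
  fixes S :: "'b \<Rightarrow> 'a set"
  assumes "finite C" and I: "finite I"
    and "\<And>c. c \<in> C \<Longrightarrow> S c \<subseteq> I \<and> S c \<noteq> {} \<and> card (S c) \<le> e + 1"
  shows "\<exists>(lab :: 'a \<Rightarrow> 'a) g. (\<forall>c\<in>C. \<forall>i\<in>S c. lab i = g c) \<and> (\<forall>c\<in>C. g c \<in> lab ` I) \<and>
    (\<forall>L\<in>lab ` I. card {i \<in> I. lab i = L} \<le> e * card {c \<in> C. g c = L} + 1)"
  using assms(1,3)
proof (induction C)
  case empty
  have "{i \<in> I. i = L} = {L}" if "L \<in> I" for L using that by auto
  then show ?case by (intro exI[of _ id] exI[of _ "\<lambda>_. undefined"]) simp
next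
  case (insert c C)
  have "\<exists>(lab :: 'a \<Rightarrow> 'a) g. (\<forall>d\<in>C. \<forall>i\<in>S d. lab i = g d) \<and> (\<forall>d\<in>C. g d \<in> lab ` I) \<and>
      (\<forall>L\<in>lab ` I. card {i \<in> I. lab i = L} \<le> e * card {d \<in> C. g d = L} + 1)"
    by (rule insert.IH) (rule insert.prems, simp)
  then obtain lab :: "'a \<Rightarrow> 'a" and g where
    lab0: "\<forall>d\<in>C. \<forall>i\<in>S d. lab i = g d" and
    g0: "\<forall>d\<in>C. g d \<in> lab ` I" and
    le0: "\<forall>L\<in>lab ` I. card {i \<in> I. lab i = L} \<le> e * card {d \<in> C. g d = L} + 1"
    by (elim exE conjE)
  have lab: "lab i = g d" if "d \<in> C" "i \<in> S d" for d i using lab0 that by blast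
  have g: "g d \<in> lab ` I" if "d \<in> C" for d using g0 that by blast
  have le: "card {i \<in> I. lab i = L} \<le> e * card {d \<in> C. g d = L} + 1" if "L \<in> lab ` I" for L
    using le0 that by blast
  have Sc: "S c \<subseteq> I" "S c \<noteq> {}" "card (S c) \<le> e + 1" using insert.prems by auto
  define T where "T = lab ` S c"
  have finT: "finite T" using Sc(1) I finite_subset by (auto simp: T_def)
  have TI: "T \<subseteq> lab ` I" using Sc by (auto simp: T_def)
  have cT: "card T \<le> e + 1"
    unfolding T_def using Sc I by (meson card_image_le finite_subset order_trans)
  obtain L0 where L0: "L0 \<in> T" using Sc by (auto simp: T_def)
  define lab' where "lab' = (\<lambda>i. if lab i \<in> T then L0 else lab i)"
  define g' where "g' = (\<lambda>d. if d = c \<or> g d \<in> T then L0 else g d)"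
  have im: "lab' ` I \<subseteq> insert L0 (lab ` I - T)" by (auto simp: lab'_def)
  have L0im: "L0 \<in> lab' ` I"
  proof -
    obtain i where "i \<in> I" "lab i = L0" using L0 TI by auto
    then show ?thesis using L0 by (force simp: lab'_def)
  qed
  have "lab' i = g' d" if "d \<in> insert c C" "i \<in> S d" for d i
  proof (cases "d = c")
    case True
    then show ?thesis using that by (simp add: lab'_def g'_def T_def)
  next
    case False
    then have "lab i = g d" using that by (intro lab) auto
    then show ?thesis using False by (simp add: lab'_def g'_def)
  qed
  moreover have "g' d \<in> lab' ` I" if "d \<in> insert c C" for d
  proof (cases "d = c \<or> g d \<in> T")
    case False
    then have "g d \<in> lab ` I" using that by (intro g) auto
    then obtain i where "i \<in> I" "lab i = g d" by auto
    then show ?thesis using False by (force simp: lab'_def g'_def)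
  qed (simp add: g'_def L0im)
  moreover have "card {i \<in> I. lab' i = L} \<le> e * card {d \<in> insert c C. g' d = L} + 1" if L: "L \<in> lab' ` I" for L
  proof (cases "L = L0")
    case False
    then have "L \<in> lab ` I" "L \<notin> T" using im L by auto
    then have "{i \<in> I. lab' i = L} = {i \<in> I. lab i = L}" "{d \<in> insert c C. g' d = L} = {d \<in> C. g d = L}"
      using False insert.hyps by (auto simp: lab'_def g'_def)
    then show ?thesis using le[OF \<open>L \<in> lab ` I\<close>] by simp
  next
    case True
    have "{i \<in> I. lab' i = L} = {i \<in> I. lab i \<in> T}"
      using True L0 by (auto simp: lab'_def)
    then have "card {i \<in> I. lab' i = L} = card {i \<in> I. lab i \<in> T}" by simp
    also have "\<dots> = (\<Sum>L\<in>T. card {i \<in> {i \<in> I. lab i \<in> T}. lab i = L})"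
      using I finT by (intro card_eq_sum_fibres[symmetric]) auto
    also have "\<dots> \<le> (\<Sum>L\<in>T. e * card {d \<in> {d \<in> C. g d \<in> T}. g d = L} + 1)"
    proof (rule sum_mono)
      fix L assume "L \<in> T"
      then have "{i \<in> {i \<in> I. lab i \<in> T}. lab i = L} = {i \<in> I. lab i = L}"
        "{d \<in> {d \<in> C. g d \<in> T}. g d = L} = {d \<in> C. g d = L}" by auto
      then show "card {i \<in> {i \<in> I. lab i \<in> T}. lab i = L} \<le> e * card {d \<in> {d \<in> C. g d \<in> T}. g d = L} + 1"
        using le[of L] TI \<open>L \<in> T\<close> by auto
    qed
    also have "\<dots> = e * (\<Sum>L\<in>T. card {d \<in> {d \<in> C. g d \<in> T}. g d = L}) + card T"
      unfolding sum.distrib sum_distrib_left[symmetric] by simp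
    also have "(\<Sum>L\<in>T. card {d \<in> {d \<in> C. g d \<in> T}. g d = L}) = card {d \<in> C. g d \<in> T}"
      using insert.hyps finT by (intro card_eq_sum_fibres) auto
    also have "e * card {d \<in> C. g d \<in> T} + card T \<le> e * (card {d \<in> C. g d \<in> T} + 1) + 1"
      using cT by simp
    also have "card {d \<in> C. g d \<in> T} + 1 = card {d \<in> insert c C. g' d = L}"
    proof -
      have "{d \<in> insert c C. g' d = L} = insert c {d \<in> C. g d \<in> T}"
        using True L0 by (auto simp: g'_def)
      then show ?thesis using insert.hyps by simp
    qed
    finally show ?thesis .
  qed
  ultimately show ?case by (intro exI[of _ lab'] exI[of _ g']) blast
qed

text \<open>A heavy consumer must draw on at least \<^term>\<open>e + 1\<close> hubs, hence on exactly that many. Mass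
  then forces the components formed by hubs and heavy consumers to be trees.\<close>
lemma feasible_contract:
  fixes k a D N1 N2 N' r A \<eta> \<eta>' e :: nat and h M M1 \<kappa> :: real
  assumes f: "feasible (k * a) h D (k * (N1 + N2)) (k * (N1 * r + N2 * (r + 1))) M \<kappa> A \<eta>"
    and A: "A + r * \<eta> = e + 1" and M: "M - real r * \<kappa> = M1" and h: "0 \<le> h" and \<kappa>: "0 \<le> \<kappa>"
    and heavy: "e * h < M1" and small: "M1 - \<kappa> < \<kappa>" and \<eta>: "1 \<le> \<eta> \<or> h \<le> \<kappa>"
    and a: "a = N' + N1 * e" and \<eta>': "\<eta>' + (e + 1) = e * D"
  shows "feasible (k * N2) (M1 - \<kappa>) (e + 1 + \<eta>) (k * N') (k * N1) h (M1 - e * h) D \<eta>'"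
proof -
  define I where "I = {..<k * a}"
  define N where "N = k * (N1 + N2)"
  have finI: "finite I" by (simp add: I_def)
  obtain \<tau> y where R: "(\<Sum>j<N. \<tau> j) = k * (N1 * r + N2 * (r + 1))" and
    y: "transport I (\<lambda>_. h) (\<lambda>_. D) {..<N} (\<lambda>j. M - real (\<tau> j) * \<kappa>) (\<lambda>j. A + \<tau> j * \<eta>) y"
    using f unfolding feasible_def N_def I_def by blast
  have pos: "0 \<le> y i j" if "i \<in> I" "j < N" for i j using y that by (auto simp: transport_def)
  have row: "(\<Sum>j<N. y i j) = h" "card {j \<in> {..<N}. y i j \<noteq> 0} \<le> D" if "i \<in> I" for i
    using y that by (auto simp: transport_def)
  have col: "(\<Sum>i\<in>I. y i j) = M - real (\<tau> j) * \<kappa>" "card {i \<in> I. y i j \<noteq> 0} \<le> A + \<tau> j * \<eta>" if "j < N" for j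
    using y that by (auto simp: transport_def)
  have yh: "y i j \<le> h" if "i \<in> I" "j < N" for i j
    using row(1)[OF that(1)] member_le_sum[of j "{..<N}" "y i"] pos that by auto
  have colle: "(\<Sum>i\<in>I. y i j) \<le> card {i \<in> I. y i j \<noteq> 0} * h" if "j < N" for j
  proof -
    have "(\<Sum>i\<in>I. y i j) = (\<Sum>i\<in>{i \<in> I. y i j \<noteq> 0}. y i j)"
      using finI by (intro sum.mono_neutral_right) auto
    also have "\<dots> \<le> card {i \<in> I. y i j \<noteq> 0} * h"
      using yh that by (intro sum_bounded_above) auto
    finally show ?thesis .
  qed
  \<comment> \<open>A type of at least \<open>r + 2\<close> would have mass at most
    \<open>M1 - 2 * \<kappa> < 0\<close>. A type \<open>r - n\<close> with \<open>n > 0\<close>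
    would have mass above \<open>e * h + n * \<kappa>\<close> in at most
    \<open>e + 1 - n * \<eta>\<close> pieces of size at most \<open>h\<close>; this is impossible as
    \<open>h \<le> \<kappa> + \<eta> * h\<close>.\<close>
  have \<tau>: "\<tau> j = r \<or> \<tau> j = r + 1" if j: "j < N" for j
  proof (rule ccontr)
    assume "\<not> ?thesis"
    then consider "\<tau> j \<ge> r + 2" | "\<tau> j + 1 \<le> r" by linarith
    then show False
    proof cases
      case 1
      then have "real (r + 2) * \<kappa> \<le> real (\<tau> j) * \<kappa>" using \<kappa> by (intro mult_right_mono) auto
      moreover have "0 \<le> M - real (\<tau> j) * \<kappa>"
        using col(1)[OF j] sum_nonneg[of I "\<lambda>i. y i j"] pos j by auto
      ultimately show False using small M by (simp add: algebra_simps)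
    next
      case 2
      then obtain x where x: "r = \<tau> j + 1 + x" by (metis le_Suc_ex)
      have "M - real (\<tau> j) * \<kappa> \<le> (A + \<tau> j * \<eta>) * h"
      proof -
        have "real (card {i \<in> I. y i j \<noteq> 0}) * h \<le> real (A + \<tau> j * \<eta>) * h"
          using col(2)[OF j] h by (intro mult_right_mono) (simp_all only: of_nat_le_iff)
        then show ?thesis using colle[OF j] col(1)[OF j] by simp
      qed
      moreover have "M - real (\<tau> j) * \<kappa> = M1 + real (1 + x) * \<kappa>" using M x by (simp add: algebra_simps)
      moreover have "real (A + \<tau> j * \<eta>) = e + 1 - real (1 + x) * \<eta>"
        using arg_cong[OF A, of real] x by (simp add: algebra_simps)
      ultimately have "M1 + real (1 + x) * \<kappa> \<le> (e + 1 - real (1 + x) * \<eta>) * h" by simp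
      then have 1: "real (1 + x) * (\<kappa> + \<eta> * h) < h" using heavy by (simp add: algebra_simps)
      have "h \<le> \<kappa> + \<eta> * h"
      proof (cases "1 \<le> \<eta>")
        case True
        then have "1 * h \<le> real \<eta> * h" using h by (intro mult_right_mono) auto
        then show ?thesis using \<kappa> by simp
      next
        case False
        then have "\<eta> = 0" by simp
        then show ?thesis using \<eta> by simp
      qed
      moreover have "1 * (\<kappa> + \<eta> * h) \<le> real (1 + x) * (\<kappa> + \<eta> * h)"
        using \<kappa> h by (intro mult_right_mono) auto
      ultimately show False using 1 by simp
    qed
  qed
  define J1 where "J1 = {j \<in> {..<N}. \<tau> j = r}"
  define J2 where "J2 = {j \<in> {..<N}. \<tau> j = r + 1}"
  have J: "finite J1" "finite J2" "J1 \<inter> J2 = {}" "J1 \<union> J2 = {..<N}" using \<tau> by (auto simp: J1_def J2_def)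
  have sumJ: "(\<Sum>j<N. w j) = (\<Sum>j\<in>J1. w j) + (\<Sum>j\<in>J2. w j)" for w :: "nat \<Rightarrow> real"
    using J by (metis sum.union_disjoint)
  \<comment> \<open>With only two types left, the number of consumers and the sum of the types
    determine how many there are of each.\<close>
  have cards: "card J1 = k * N1" "card J2 = k * N2"
  proof -
    have 1: "card J1 + card J2 = k * N1 + k * N2"
      using J card_Un_disjoint[of J1 J2] by (simp add: N_def algebra_simps)
    have "(\<Sum>j<N. \<tau> j) = (\<Sum>j\<in>J1. \<tau> j) + (\<Sum>j\<in>J2. \<tau> j)" using J by (metis sum.union_disjoint)
    also have "\<dots> = card J1 * r + card J2 * (r + 1)" by (simp add: J1_def J2_def)
    finally have "(card J1 + card J2) * r + card J2 = (k * N1 + k * N2) * r + k * N2"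
      using R by (simp add: algebra_simps)
    then show "card J2 = k * N2" using 1 by simp
    then show "card J1 = k * N1" using 1 by simp
  qed
  have J1N: "j < N" "\<tau> j = r" if "j \<in> J1" for j using that by (auto simp: J1_def)
  have J2N: "j < N" "\<tau> j = r + 1" if "j \<in> J2" for j using that by (auto simp: J2_def)
  define S where "S = (\<lambda>j. {i \<in> I. y i j \<noteq> 0})"
  have colJ1: "(\<Sum>i\<in>I. y i j) = M1" if "j \<in> J1" for j using col(1) J1N[OF that] M by simp
  have cS: "card (S j) = e + 1" if "j \<in> J1" for j
  proof -
    have "e * h < card (S j) * h" using colle[OF J1N(1)[OF that]] colJ1[OF that] heavy by (simp add: S_def)
    then have "real e < card (S j)" using h by (simp add: mult_less_cancel_right)
    moreover have "card (S j) \<le> e + 1" using col(2)[OF J1N(1)[OF that]] J1N(2)[OF that] A by (simp add: S_def)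
    ultimately show ?thesis by simp
  qed
  have S: "S j \<subseteq> I \<and> S j \<noteq> {} \<and> card (S j) \<le> e + 1" if "j \<in> J1" for j
  proof -
    have "S j \<noteq> {}" using cS[OF that] by (intro notI) simp
    then show ?thesis using cS[OF that] by (auto simp: S_def)
  qed
  have "\<exists>(lab :: nat \<Rightarrow> nat) g. (\<forall>c\<in>J1. \<forall>i\<in>S c. lab i = g c) \<and> (\<forall>c\<in>J1. g c \<in> lab ` I) \<and>
      (\<forall>L\<in>lab ` I. card {i \<in> I. lab i = L} \<le> e * card {c \<in> J1. g c = L} + 1)"
    by (rule hyperedge_components[OF J(1) finI S])
  then obtain lab :: "nat \<Rightarrow> nat" and g where
    lab0: "\<forall>c\<in>J1. \<forall>i\<in>S c. lab i = g c" and
    g0: "\<forall>c\<in>J1. g c \<in> lab ` I" and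
    le0: "\<forall>L\<in>lab ` I. card {i \<in> I. lab i = L} \<le> e * card {c \<in> J1. g c = L} + 1"
    by (elim exE conjE)
  have lab: "lab i = g c" if "c \<in> J1" "i \<in> S c" for c i using lab0 that by blast
  have g: "g c \<in> lab ` I" if "c \<in> J1" for c using g0 that by blast
  have le: "card {i \<in> I. lab i = L} \<le> e * card {c \<in> J1. g c = L} + 1" if "L \<in> lab ` I" for L
    using le0 that by blast
  define cls where "cls = (\<lambda>L. {i \<in> I. lab i = L})"
  define hv where "hv = (\<lambda>L. {c \<in> J1. g c = L})"
  have fcls: "finite (cls L)" "cls L \<subseteq> I" for L using finI by (auto simp: cls_def)
  have clsI: "i \<in> I" if "i \<in> cls L" for i L using that by (simp add: cls_def)
  have pos2: "0 \<le> y i c" if "i \<in> cls L" "c \<in> J2" for i c L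
    using pos[OF clsI[OF that(1)] J2N(1)[OF that(2)]] .
  have clsum: "(\<Sum>i\<in>cls L. y i c) = (if g c = L then M1 else 0)" if "c \<in> J1" for c L
  proof (cases "g c = L")
    case True
    have "(\<Sum>i\<in>cls L. y i c) = (\<Sum>i\<in>I. y i c)"
      using lab[OF that] True finI by (intro sum.mono_neutral_left) (auto simp: cls_def S_def)
    then show ?thesis using colJ1[OF that] True by simp
  next
    case False
    have "(\<Sum>i\<in>cls L. y i c) = 0"
    proof (intro sum.neutral ballI)
      fix i assume "i \<in> cls L"
      then show "y i c = 0" using lab[OF that, of i] False by (auto simp: cls_def S_def)
    qed
    then show ?thesis using False by simp
  qed
  have clsumJ1: "(\<Sum>i\<in>cls L. \<Sum>c\<in>J1. y i c) = card (hv L) * M1" for L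
  proof -
    have "(\<Sum>i\<in>cls L. \<Sum>c\<in>J1. y i c) = (\<Sum>c\<in>J1. \<Sum>i\<in>cls L. y i c)" by (rule sum.swap)
    also have "\<dots> = (\<Sum>c\<in>J1. if g c = L then M1 else 0)" using clsum by (intro sum.cong) auto
    also have "\<dots> = card (hv L) * M1"
      unfolding hv_def using J by (subst sum.If_cases) (auto simp: Int_def)
    finally show ?thesis .
  qed
  have clsumJ2: "(\<Sum>i\<in>cls L. \<Sum>c\<in>J2. y i c) = card (cls L) * h - card (hv L) * M1" for L
  proof -
    have "(\<Sum>i\<in>cls L. \<Sum>c\<in>J2. y i c) = (\<Sum>i\<in>cls L. h - (\<Sum>c\<in>J1. y i c))"
    proof (rule sum.cong)
      fix i assume "i \<in> cls L"
      then show "(\<Sum>c\<in>J2. y i c) = h - (\<Sum>c\<in>J1. y i c)"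
        using row(1)[OF clsI] sumJ[of "y i"] by fastforce
    qed simp
    then show ?thesis by (simp add: sum_subtractf clsumJ1)
  qed
  \<comment> \<open>The upper bound is connectivity. For the lower bound, the hubs of the component
    must hold the mass of its heavy consumers, each more than \<open>e * h\<close>.\<close>
  have size: "card (cls L) = e * card (hv L) + 1" if L: "L \<in> lab ` I" for L
  proof (rule antisym)
    show "card (cls L) \<le> e * card (hv L) + 1" using le[OF L] by (simp add: cls_def hv_def)
    show "e * card (hv L) + 1 \<le> card (cls L)"
    proof (cases "card (hv L) = 0")
      case True
      have "cls L \<noteq> {}" using L by (auto simp: cls_def)
      then show ?thesis using True fcls(1)[of L] by (simp add: Suc_le_eq card_gt_0_iff)
    next
      case False
      have "0 \<le> (\<Sum>i\<in>cls L. \<Sum>c\<in>J2. y i c)"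
        by (intro sum_nonneg) (rule pos2)
      then have "card (hv L) * M1 \<le> card (cls L) * h" using clsumJ2[of L] by simp
      moreover have "card (hv L) * (e * h) < card (hv L) * M1" using heavy False by simp
      ultimately have "(e * card (hv L)) * h < card (cls L) * h" by (simp add: algebra_simps)
      then have "real (e * card (hv L)) < card (cls L)" using h by (simp add: mult_less_cancel_right)
      then have "e * card (hv L) < card (cls L)" by (simp only: of_nat_less_iff)
      then show ?thesis by simp
    qed
  qed
  have finL: "finite (lab ` I)" using finI by simp
  have sumhv: "(\<Sum>L\<in>lab ` I. card (hv L)) = k * N1"
    unfolding hv_def cards(1)[symmetric] using J finL g by (intro card_eq_sum_fibres) auto
  have "(\<Sum>L\<in>lab ` I. card (cls L)) = card I"
    unfolding cls_def using finI by (intro card_eq_sum_fibres) auto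
  moreover have "(\<Sum>L\<in>lab ` I. card (cls L)) = (\<Sum>L\<in>lab ` I. e * card (hv L) + 1)"
    using size by (intro sum.cong) auto
  \<comment> \<open>Counting hubs tree by tree shows that the number of trees is
    \<open>k * N'\<close>, so the factor \<open>k\<close> is passed on to the contraction.\<close>
  ultimately have "k * a = e * (k * N1) + card (lab ` I)"
    using sumhv by (simp only: I_def sum.distrib sum_distrib_left[symmetric] card_lessThan) simp
  then have cardL: "card (lab ` I) = k * N'" using a by (simp add: algebra_simps)
  define z where "z = (\<lambda>c L. \<Sum>i\<in>cls L. y i c)"
  have "transport J2 (\<lambda>_. M1 - \<kappa>) (\<lambda>_. e + 1 + \<eta>) (lab ` I) (\<lambda>L. h - real (card (hv L)) * (M1 - e * h))
      (\<lambda>L. D + card (hv L) * \<eta>') z"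
    unfolding transport_def
  proof (intro conjI ballI)
    fix c L assume "c \<in> J2" "L \<in> lab ` I"
    then show "0 \<le> z c L" unfolding z_def by (intro sum_nonneg) (rule pos2)
  next
    fix c assume c: "c \<in> J2"
    have "(\<Sum>L\<in>lab ` I. z c L) = (\<Sum>i\<in>I. y i c)"
      unfolding z_def cls_def using finI by (intro sum.group) auto
    then show "(\<Sum>L\<in>lab ` I. z c L) = M1 - \<kappa>" using col(1) J2N[OF c] M by (simp add: algebra_simps)
    have "{L \<in> lab ` I. z c L \<noteq> 0} \<subseteq> lab ` {i \<in> I. y i c \<noteq> 0}"
    proof
      fix L assume "L \<in> {L \<in> lab ` I. z c L \<noteq> 0}"
      then obtain i where "i \<in> cls L" "y i c \<noteq> 0" unfolding z_def by (auto elim: sum.not_neutral_contains_not_neutral)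
      then show "L \<in> lab ` {i \<in> I. y i c \<noteq> 0}" by (auto simp: cls_def)
    qed
    then have "card {L \<in> lab ` I. z c L \<noteq> 0} \<le> card (lab ` {i \<in> I. y i c \<noteq> 0})"
      using finI by (intro card_mono) auto
    also have "\<dots> \<le> card {i \<in> I. y i c \<noteq> 0}" using finI by (intro card_image_le) auto
    also have "\<dots> \<le> e + 1 + \<eta>" using col(2)[OF J2N(1)[OF c]] J2N(2)[OF c] A by (simp add: algebra_simps)
    finally show "card {L \<in> lab ` I. z c L \<noteq> 0} \<le> e + 1 + \<eta>" .
  next
    fix L assume L: "L \<in> lab ` I"
    have "(\<Sum>c\<in>J2. z c L) = (\<Sum>i\<in>cls L. \<Sum>c\<in>J2. y i c)" unfolding z_def by (rule sum.swap)
    then show "(\<Sum>c\<in>J2. z c L) = h - real (card (hv L)) * (M1 - e * h)"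
      using clsumJ2[of L] size[OF L] by (simp add: algebra_simps)
    define n where "n = (\<lambda>X i. card {c \<in> X. y i c \<noteq> 0})"
    have nJ: "n J1 i + n J2 i \<le> D" if "i \<in> cls L" for i
    proof -
      have "{c \<in> {..<N}. y i c \<noteq> 0} = {c \<in> J1. y i c \<noteq> 0} \<union> {c \<in> J2. y i c \<noteq> 0}" using J by auto
      then have "card {c \<in> {..<N}. y i c \<noteq> 0} = n J1 i + n J2 i"
        unfolding n_def using J by (simp add: card_Un_disjoint disjoint_iff)
      then show ?thesis using row(2)[OF clsI[OF that]] by simp
    qed
    \<comment> \<open>Of the \<open>card (cls L) * D\<close> places of the tree, each heavy consumer
      occupies exactly \<open>e + 1\<close>; the rest bounds the degree towards the other
      consumers.\<close>
    have nJ1: "(\<Sum>i\<in>cls L. n J1 i) = card (hv L) * (e + 1)"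
    proof -
      have "(\<Sum>i\<in>cls L. n J1 i) = (\<Sum>i\<in>cls L. \<Sum>c\<in>J1. of_bool (y i c \<noteq> 0))"
        unfolding n_def using J by (simp add: sum.If_cases Int_def)
      also have "\<dots> = (\<Sum>c\<in>J1. \<Sum>i\<in>cls L. of_bool (y i c \<noteq> 0))" by (rule sum.swap)
      also have "\<dots> = (\<Sum>c\<in>J1. card {i \<in> cls L. y i c \<noteq> 0})"
        using fcls by (simp add: sum.If_cases Int_def)
      also have "\<dots> = (\<Sum>c\<in>J1. if g c = L then e + 1 else 0)"
      proof (intro sum.cong refl)
        fix c assume c: "c \<in> J1"
        show "card {i \<in> cls L. y i c \<noteq> 0} = (if g c = L then e + 1 else 0)"
        proof (cases "g c = L")
          case True
          then have "{i \<in> cls L. y i c \<noteq> 0} = S c" using lab[OF c] by (auto simp: S_def cls_def)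
          then show ?thesis using True cS[OF c] by simp
        next
          case False
          have "lab i = g c" if "i \<in> cls L" "y i c \<noteq> 0" for i
            using that by (intro lab[OF c]) (simp add: S_def cls_def)
          then have "{i \<in> cls L. y i c \<noteq> 0} = {}" using False by (auto simp: cls_def)
          then show ?thesis using False by (simp only: card.empty if_False)
        qed
      qed
      also have "\<dots> = card (hv L) * (e + 1)"
        unfolding hv_def using J by (subst sum.If_cases) (auto simp: Int_def)
      finally show ?thesis .
    qed
    have "{c \<in> J2. z c L \<noteq> 0} \<subseteq> (\<Union>i\<in>cls L. {c \<in> J2. y i c \<noteq> 0})"
      unfolding z_def by (auto elim: sum.not_neutral_contains_not_neutral)
    then have "card {c \<in> J2. z c L \<noteq> 0} \<le> card (\<Union>i\<in>cls L. {c \<in> J2. y i c \<noteq> 0})"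
      using J fcls by (intro card_mono) auto
    also have "\<dots> \<le> (\<Sum>i\<in>cls L. n J2 i)" unfolding n_def using fcls by (intro card_UN_le) auto
    finally have "card {c \<in> J2. z c L \<noteq> 0} + card (hv L) * (e + 1) \<le> (\<Sum>i\<in>cls L. n J1 i + n J2 i)"
      using nJ1 by (simp add: sum.distrib)
    also have "\<dots> \<le> card (cls L) * D" using sum_bounded_above[of "cls L" "\<lambda>i. n J1 i + n J2 i" D] nJ by simp
    also have "\<dots> = card (hv L) * (e * D) + D" using size[OF L] by (simp add: algebra_simps)
    also have "\<dots> = card (hv L) * \<eta>' + card (hv L) * (e + 1) + D"
      unfolding \<eta>'[symmetric] by (simp add: algebra_simps)
    finally show "card {c \<in> J2. z c L \<noteq> 0} \<le> D + card (hv L) * \<eta>'" by simp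
  qed
  then show ?thesis using cards(2) cardL sumhv J finL by (intro feasibleI) auto
qed

section \<open>Problems without heavy consumers\<close>

lemma transport_uniform_masses:
  fixes h M :: real
  assumes "0 < a" "0 < b" "0 \<le> h" "real a * h = real b * M" "2 \<le> D" "2 \<le> A"
    "b \<le> (D - 1) * a" "a \<le> (A - 1) * b"
  shows "\<exists>y. transport {..<a} (\<lambda>_. h) (\<lambda>_. D) {..<b} (\<lambda>_. M) (\<lambda>_. A) y"
proof -
  have "real a * (h / b) = M" using assms(2,4) by (simp add: field_simps)
  moreover have "real b * (h / b) = h" using assms(2) by simp
  ultimately show ?thesis
    using transport_uniform[of a b "h / b" D A] assms by simp
qed

text \<open>When \<open>M1 = \<kappa>\<close>, consumers of type \<open>r + 1\<close> have mass zero
  and receive nothing, so the masses are equal on each side. The inequality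
  \<open>a \<le> e * N1\<close> needed for the end-to-end layout comes from the balance and
  \<open>M1 \<le> e * h\<close>.\<close>

lemma feasible_two_valued:
  fixes a D N1 N2 r A \<eta> e :: nat and h M M1 \<kappa> :: real
  assumes "0 < a" "0 < N1" "0 \<le> h" and mass: "real a * h = real N1 * M1" and "0 \<le> M1" "M1 \<le> e * h"
    and "1 \<le> e" "2 \<le> D" "N1 \<le> (D - 1) * a" and N2: "0 < N2 \<Longrightarrow> M1 = \<kappa>"
    and M: "M - real r * \<kappa> = M1" and A: "A + r * \<eta> = e + 1"
  shows "feasible a h D (N1 + N2) (N1 * r + N2 * (r + 1)) M \<kappa> A \<eta>"
proof -
  have "\<exists>y. transport {..<a} (\<lambda>_. h) (\<lambda>_. D) {..<N1} (\<lambda>_. M1) (\<lambda>_. e + 1) y"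
  proof (cases "M1 = 0")
    case True
    then have "h = 0" using mass assms by simp
    then show ?thesis using True by (intro exI[of _ "\<lambda>_ _. 0"]) (simp add: transport_def)
  next
    case False
    then have "h > 0" using assms by (cases "h = 0") auto
    moreover have "real a * h \<le> real N1 * (e * h)" using mass assms by (simp add: mult_left_mono)
    ultimately have "real a \<le> real (N1 * e)" by simp
    then have "a \<le> (e + 1 - 1) * N1" by (simp only: of_nat_le_iff) (simp add: mult.commute)
    then show ?thesis using assms by (intro transport_uniform_masses) auto
  qed
  then obtain y where y: "transport {..<a} (\<lambda>_. h) (\<lambda>_. D) {..<N1} (\<lambda>_. M1) (\<lambda>_. e + 1) y" by blast
  define z where "z = (\<lambda>i j. if j < N1 then y i j else 0)"
  define \<tau> where "\<tau> = (\<lambda>j. if j < N1 then r else r + 1)"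
  have "(\<Sum>j<N1 + N'. \<tau> j) = N1 * r + N' * (r + 1)" for N'
    by (induction N') (auto simp: \<tau>_def)
  moreover have "transport {..<a} (\<lambda>_. h) (\<lambda>_. D) {..<N1 + N2} (\<lambda>j. M - real (\<tau> j) * \<kappa>) (\<lambda>j. A + \<tau> j * \<eta>) z"
    unfolding transport_def
  proof (intro conjI ballI)
    fix i assume i: "i \<in> {..<a}"
    have "(\<Sum>j<N1 + N2. z i j) = (\<Sum>j<N1. y i j)"
      by (intro sum.mono_neutral_cong_right) (auto simp: z_def)
    then show "(\<Sum>j<N1 + N2. z i j) = h" using y i by (simp add: transport_def)
    have "{j \<in> {..<N1 + N2}. z i j \<noteq> 0} = {j \<in> {..<N1}. y i j \<noteq> 0}" by (auto simp: z_def)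
    then show "card {j \<in> {..<N1 + N2}. z i j \<noteq> 0} \<le> D" using y i by (simp add: transport_def)
  next
    fix j assume j: "j \<in> {..<N1 + N2}"
    show "(\<Sum>i<a. z i j) = M - real (\<tau> j) * \<kappa>"
    proof (cases "j < N1")
      case False
      then have "M1 = \<kappa>" using j N2 by simp
      then show ?thesis using False M by (simp add: z_def \<tau>_def algebra_simps)
    qed (use y M in \<open>simp add: transport_def z_def \<tau>_def\<close>)
    show "card {i \<in> {..<a}. z i j \<noteq> 0} \<le> A + \<tau> j * \<eta>"
      using y A by (cases "j < N1") (auto simp: transport_def z_def \<tau>_def)
  qed (use y in \<open>auto simp: transport_def z_def\<close>)
  ultimately show ?thesis unfolding feasible_def by blast
qed

text \<open>Lowering every mass by \<^term>\<open>t\<close> times its degree preserves the balance. We increase \<^term>\<open>t\<close>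
  until either the smaller consumers have mass zero, or the contraction has equal masses on each side;
  in both cases the masses can be laid end to end.\<close>
lemma feasible_light:
  fixes a D N1 N2 r A \<eta> e :: nat and h M M1 \<kappa> :: real
  assumes N1: "0 < N1" and D: "2 \<le> D" and e: "1 \<le> e" and A: "A + r * \<eta> = e + 1" and \<kappa>: "0 \<le> \<kappa>"
    and deg: "a * D = N1 * (e + 1) + N2 * (e + 1 + \<eta>)"
    and mass: "real a * h = real N1 * M1 + real N2 * (M1 - \<kappa>)"
    and M: "M - real r * \<kappa> = M1" and M1: "0 \<le> M1" and M2: "0 < N2 \<Longrightarrow> 0 \<le> M1 - \<kappa>"
    and light: "M1 \<le> e * h"
  shows "feasible a h D (N1 + N2) (N1 * r + N2 * (r + 1)) M \<kappa> A \<eta>"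
proof -
  have h: "0 \<le> h"
  proof -
    have "0 \<le> e * h" using M1 light by linarith
    then show ?thesis using e by (simp add: zero_le_mult_iff)
  qed
  have a: "0 < a" using deg N1 by (cases a) auto
  \<comment> \<open>Each of the \<open>N1\<close> consumers has degree at least 2, and
    \<open>D \<le> 2 * (D - 1)\<close>.\<close>
  have N1a: "N1 \<le> (D - 1) * a"
  proof -
    have "2 * N1 \<le> N1 * (e + 1)" using e by simp
    also have "\<dots> \<le> a * D" using deg by simp
    also have "\<dots> \<le> 2 * ((D - 1) * a)"
    proof -
      obtain D' where "D = D' + 2" using D by (metis add.commute le_Suc_ex)
      then show ?thesis by (simp add: algebra_simps)
    qed
    finally show ?thesis by simp
  qed
  show ?thesis
  proof (cases "N2 = 0")
    case True
    then show ?thesis using assms h a N1a by (intro feasible_two_valued[of _ _ _ M1 e]) auto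
  next
    case False
    then have N2: "0 < N2" by simp
    define A2 where "A2 = e + 1 + \<eta>"
    have degR: "real a * D = real N1 * (e + 1) + real N2 * A2"
      using arg_cong[OF deg, of real] by (simp add: A2_def algebra_simps)
    have degF: "a * D = (N1 + N2) * A + (N1 * r + N2 * (r + 1)) * \<eta>"
    proof -
      have "(N1 + N2) * A + (N1 * r + N2 * (r + 1)) * \<eta> = N1 * (A + r * \<eta>) + N2 * (A + r * \<eta> + \<eta>)"
        by (simp add: algebra_simps)
      then show ?thesis unfolding A deg by simp
    qed
    have A2pos: "0 < real A2" by (simp add: A2_def)
    define t1 where "t1 = (M1 - \<kappa>) / A2"
    have t1: "0 \<le> t1" "(M1 - \<kappa>) - t1 * A2 = 0" using M2[OF N2] A2pos by (auto simp: t1_def)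
    have sh: "real a * (h - t * D) = real N1 * (M1 - t * (e + 1)) + real N2 * ((M1 - \<kappa>) - t * A2)" for t :: real
    proof -
      have "real a * (h - t * D) = real a * h - t * (real a * D)" by (simp add: algebra_simps)
      also have "\<dots> = real N1 * (M1 - t * (e + 1)) + real N2 * ((M1 - \<kappa>) - t * A2)"
        unfolding mass degR by (simp add: algebra_simps)
      finally show ?thesis .
    qed
    have shM: "(M - t * A) - real r * (\<kappa> + t * \<eta>) = M1 - t * (e + 1)" for t :: real
    proof -
      have "(M - t * A) - real r * (\<kappa> + t * \<eta>) = (M - real r * \<kappa>) - t * real (A + r * \<eta>)"
        by (simp add: algebra_simps)
      then show ?thesis unfolding M A by simp
    qed
    have shK: "(M1 - t * (e + 1)) - (\<kappa> + t * \<eta>) = (M1 - \<kappa>) - t * A2" for t :: real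
      by (simp add: A2_def algebra_simps)
    have \<kappa>t: "0 \<le> \<kappa> + t * \<eta>" if "0 \<le> t" for t :: real using \<kappa> that by simp
    show ?thesis
    \<comment> \<open>At \<open>t1\<close> the consumers of type \<open>r + 1\<close> vanish; the
      question is whether the others are still light by then.\<close>
    proof (cases "M1 - t1 * (e + 1) \<le> e * (h - t1 * D)")
      case True
      have m1: "0 \<le> M1 - t1 * (e + 1)" using shK[of t1] t1 \<kappa>t[of t1] by linarith
      have h1: "0 \<le> h - t1 * D"
      proof -
        have "0 \<le> e * (h - t1 * D)" using m1 True by linarith
        then show ?thesis using e by (simp add: zero_le_mult_iff)
      qed
      have "feasible a (h - t1 * D) D (N1 + N2) (N1 * r + N2 * (r + 1)) (M - t1 * A) (\<kappa> + t1 * \<eta>) A \<eta>"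
      proof (rule feasible_two_valued[OF a N1 h1 _ m1 True e D N1a _ shM A])
        show "real a * (h - t1 * D) = real N1 * (M1 - t1 * (e + 1))" using sh[of t1] t1(2) by simp
        show "M1 - t1 * (e + 1) = \<kappa> + t1 * \<eta>" using shK[of t1] t1(2) by linarith
      qed
      from feasible_shift[OF this t1(1) degF] show ?thesis .
    next
      case not_light: False
      define \<kappa>' where "\<kappa>' = M1 - e * h"
      define \<eta>r where "\<eta>r = real e * D - (e + 1)"
      have lin: "(M1 - t * (e + 1)) - e * (h - t * D) = \<kappa>' + t * \<eta>r" for t :: real
        by (simp add: \<kappa>'_def \<eta>r_def algebra_simps)
      have k0: "\<kappa>' \<le> 0" using light by (simp add: \<kappa>'_def)
      have k1: "0 < \<kappa>' + t1 * \<eta>r" using not_light lin[of t1] by linarith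
      have \<eta>r: "0 < \<eta>r"
        using k0 k1 t1(1) by (metis add_nonpos_nonpos linorder_not_less mult_nonneg_nonpos)
      \<comment> \<open>The excess of the larger consumers over \<open>e\<close> hubs is affine in
        the shift, at most 0 at shift 0 and positive at \<open>t1\<close>; \<open>t\<close> is its
        zero. There the contracted slope vanishes: every tree has mass \<open>h'\<close>, whatever
        its number of heavy consumers.\<close>
      define t where "t = - \<kappa>' / \<eta>r"
      have t0: "0 \<le> t" using k0 \<eta>r by (simp add: t_def divide_nonpos_pos)
      have tt1: "t < t1" using k1 \<eta>r by (simp add: t_def field_simps)
      have eq: "M1 - t * (e + 1) = e * (h - t * D)" using lin[of t] \<eta>r by (simp add: t_def)
      define h' where "h' = h - t * D"
      define m2 where "m2 = (M1 - \<kappa>) - t * A2"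
      have m2: "0 < m2"
      proof -
        have "t * A2 < t1 * A2" using tt1 A2pos by simp
        then show ?thesis using t1(2) by (simp add: m2_def)
      qed
      have h': "0 < h'"
      proof -
        have "0 < M1 - t * (e + 1)" using shK[of t] m2 \<kappa>t[OF t0] by (simp add: m2_def)
        then have "0 < e * h'" using eq by (simp add: h'_def)
        then show ?thesis using e by (simp add: zero_less_mult_iff)
      qed
      have bal: "real a * h' = real N1 * (e * h') + real N2 * m2"
        using sh[of t] eq by (simp add: h'_def m2_def)
      have "real N1 * e * h' < real a * h'" using bal m2 N2 by (simp add: mult.assoc)
      then have "real (N1 * e) < real a" using h' by (simp add: mult_less_cancel_right)
      then have Na: "N1 * e < a" by (simp only: of_nat_less_iff)
      define N' where "N' = a - N1 * e"
      have N': "0 < N'" "a = N' + N1 * e" using Na by (auto simp: N'_def)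
      have bal': "real N2 * m2 = real N' * h'"
        using bal N'(2) by (simp add: algebra_simps)
      define \<eta>' where "\<eta>' = e * D - (e + 1)"
      have \<eta>': "\<eta>' + (e + 1) = e * D"
      proof -
        have "e + 1 \<le> e * D"
          using \<eta>r unfolding \<eta>r_def by (metis diff_gt_0_iff_gt less_imp_le of_nat_1 of_nat_add of_nat_le_iff of_nat_mult)
        then show ?thesis by (simp add: \<eta>'_def)
      qed
      have deg': "N2 * A2 = N' * D + N1 * \<eta>'"
      proof -
        have "N1 * (\<eta>' + (e + 1)) = N1 * (e * D)" unfolding \<eta>' ..
        moreover have "(N' + N1 * e) * D = N1 * (e + 1) + N2 * A2"
          using deg N'(2) by (simp add: A2_def)
        ultimately show ?thesis by (simp add: algebra_simps)
      qed
      define q where "q = N1 div N'"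
      have q: "N1 = q * N' + N1 mod N'" "N1 mod N' < N'" using N' by (auto simp: q_def)
      have A2_2: "2 \<le> A2" using e by (simp add: A2_def)
      have c1: "N' \<le> (A2 - 1) * N2"
      proof -
        have "N' * 2 \<le> N' * D" using D by simp
        also have "\<dots> \<le> N2 * A2" using deg' by simp
        also have "\<dots> \<le> 2 * ((A2 - 1) * N2)"
        proof -
          obtain A' where "A2 = A' + 2" using A2_2 by (metis add.commute le_Suc_ex)
          then show ?thesis by (simp add: algebra_simps)
        qed
        finally show ?thesis by simp
      qed
      \<comment> \<open>The layout is to respect the smaller degree \<open>D + q * \<eta>'\<close>,
        whereas counting degrees bounds \<open>N2 * A2\<close> by the larger one,
        \<open>D + (q + 1) * \<eta>'\<close>, per tree. The gap is bridged by
        \<open>D + \<eta>' = (D - 1) * (e + 1)\<close> if \<open>q = 0\<close> and by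
        \<open>\<eta>' \<le> q * \<eta>'\<close> otherwise.\<close>
      have c2: "N2 \<le> (D + q * \<eta>' - 1) * N'"
      proof -
        have N1': "N1 \<le> (q + 1) * N'" using q by (simp add: algebra_simps)
        have up: "N2 * A2 \<le> N' * (D + (q + 1) * \<eta>')"
        proof -
          have "N1 * \<eta>' \<le> (q + 1) * N' * \<eta>'" using N1' by (rule mult_le_mono1)
          then show ?thesis unfolding deg' by (simp add: algebra_simps)
        qed
        show ?thesis
        proof (cases "q = 0")
          case True
          have "D + \<eta>' \<le> (D - 1) * A2"
          proof -
            obtain D' where D': "D = D' + 1" using D by (metis add.commute le_Suc_ex one_le_numeral order_trans)
            have "D + \<eta>' = (D - 1) * (e + 1)" using \<eta>' D' by (simp add: algebra_simps)
            then show ?thesis by (simp add: A2_def)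
          qed
          then have "N2 * A2 \<le> N' * ((D - 1) * A2)" using up True by (metis Groups.mult_ac(2) add_0 le_trans mult_1 mult_le_mono2)
          then have "N2 * A2 \<le> (N' * (D - 1)) * A2" by (simp add: mult.assoc)
          then have "N2 \<le> N' * (D - 1)" using A2_2 by simp
          then show ?thesis using True by (simp add: mult.commute)
        next
          case False
          have "N2 * 2 \<le> N2 * A2" using A2_2 by simp
          also note up
          also have "N' * (D + (q + 1) * \<eta>') \<le> N' * (2 * (D + q * \<eta>' - 1))"
          proof (rule mult_le_mono2)
            have "\<eta>' \<le> q * \<eta>'" using False by simp
            then show "D + (q + 1) * \<eta>' \<le> 2 * (D + q * \<eta>' - 1)" using D by (simp only: add_mult_distrib mult_1)
          qed
          finally show ?thesis by (simp add: algebra_simps)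
        qed
      qed
      obtain y where y: "transport {..<N2} (\<lambda>_. m2) (\<lambda>_. A2) {..<N'} (\<lambda>_. h') (\<lambda>_. D + q * \<eta>') y"
        using transport_uniform_masses[of N2 N' m2 h' A2 "D + q * \<eta>'"] N2 N' bal' A2_2 c1 c2 m2 D by auto
      \<comment> \<open>At slope 0 the types influence only the degrees; spreading the heavy
        consumers evenly keeps every degree at least \<open>D + q * \<eta>'\<close>.\<close>
      define \<tau> where "\<tau> = (\<lambda>j. if j < N1 mod N' then q + 1 else q)"
      have "(\<Sum>j<n. \<tau> j) = q * n + min n (N1 mod N')" for n
        by (induction n) (auto simp: \<tau>_def)
      then have "(\<Sum>j<N'. \<tau> j) = N1" using q by simp
      moreover have "transport {..<N2} (\<lambda>_. m2) (\<lambda>_. A2) {..<N'} (\<lambda>j. h' - real (\<tau> j) * 0) (\<lambda>j. D + \<tau> j * \<eta>') y"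
        by (rule transport_cong[OF _ _ _ _ y]) (auto simp: \<tau>_def)
      ultimately have "feasible N2 m2 A2 N' N1 h' 0 D \<eta>'" unfolding feasible_def by blast
      then have "feasible a h' D (N1 + N2) (N1 * r + N2 * (r + 1)) (M - t * A) (\<kappa> + t * \<eta>) A \<eta>"
      proof (rule feasible_expand[OF _ order_refl e D \<eta>' N'(2) _ _ _ _ A])
        show "N1 + N2 = N2 + N1" by simp
        show "N1 * r + N2 * (r + 1) = N2 * (r + 1) + N1 * r" by simp
        show "M - t * A - real r * (\<kappa> + t * \<eta>) = 0 + e * h'" using shM[of t] eq by (simp add: h'_def)
        show "m2 = M - t * A - real (r + 1) * (\<kappa> + t * \<eta>)"
          using shM[of t] shK[of t] unfolding m2_def by (simp add: distrib_right)
        show "A2 = A + (r + 1) * \<eta>" using A by (simp add: A2_def)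
      qed
      from feasible_shift[OF this[unfolded h'_def] t0 degF] show ?thesis .
    qed
  qed
qed

section \<open>Descent\<close>

text \<open>An average type above \<open>q\<close> forces a consumer of type at least
  \<open>q + 1\<close>, whose mass cannot be negative; an average below \<open>q + 1\<close> forces
  one of type at most \<open>q\<close>, which takes at most \<open>h\<close> from each of its hubs.
  Only ratios of \<open>a\<close>, \<open>N\<close> and \<open>R\<close> matter, so a solution of
  the \<open>k\<close>-fold problem yields these inequalities for the original one.\<close>

lemma feasible_bounds:
  fixes h M \<kappa> :: real
  assumes f: "feasible a h D N R M \<kappa> A \<eta>" and a: "0 < a" and \<kappa>: "0 \<le> \<kappa>"
  shows "0 \<le> h" and "a * h = N * M - R * \<kappa>"
    and "q * N < R \<Longrightarrow> 0 \<le> M - real (q + 1) * \<kappa>"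
    and "R < (q + 1) * N \<Longrightarrow> M - real q * \<kappa> \<le> real (A + q * \<eta>) * h"
proof -
  obtain \<tau> y where R: "(\<Sum>j<N. \<tau> j) = R" and
    y: "transport {..<a} (\<lambda>_. h) (\<lambda>_. D) {..<N} (\<lambda>j. M - real (\<tau> j) * \<kappa>) (\<lambda>j. A + \<tau> j * \<eta>) y"
    using f unfolding feasible_def by blast
  have pos: "0 \<le> y i j" if "i < a" "j < N" for i j using y that by (auto simp: transport_def)
  have row: "(\<Sum>j<N. y i j) = h" if "i < a" for i using y that by (auto simp: transport_def)
  have col: "(\<Sum>i<a. y i j) = M - real (\<tau> j) * \<kappa>" "card {i \<in> {..<a}. y i j \<noteq> 0} \<le> A + \<tau> j * \<eta>"
    if "j < N" for j using y that by (auto simp: transport_def)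
  show h: "0 \<le> h" using row[OF a] sum_nonneg[of "{..<N}" "y 0"] pos[OF a] by auto
  have "a * h = (\<Sum>i<a. \<Sum>j<N. y i j)" using row by simp
  also have "\<dots> = (\<Sum>j<N. \<Sum>i<a. y i j)" by (rule sum.swap)
  also have "\<dots> = (\<Sum>j<N. M - real (\<tau> j) * \<kappa>)" using col by simp
  also have "\<dots> = N * M - R * \<kappa>"
    by (simp add: sum_subtractf sum_distrib_right[symmetric] R[symmetric])
  finally show "a * h = N * M - R * \<kappa>" .
  show "0 \<le> M - real (q + 1) * \<kappa>" if q: "q * N < R"
  proof -
    have "\<exists>j<N. q + 1 \<le> \<tau> j"
    proof (rule ccontr)
      assume "\<not> ?thesis"
      then have "(\<Sum>j<N. \<tau> j) \<le> (\<Sum>j<N. q)" by (intro sum_mono) (auto simp: not_le)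
      then show False using q R by (simp add: mult.commute)
    qed
    then obtain j where j: "j < N" "q + 1 \<le> \<tau> j" by blast
    have "0 \<le> M - real (\<tau> j) * \<kappa>" using col(1)[OF j(1)] sum_nonneg[of "{..<a}" "\<lambda>i. y i j"] pos j by auto
    moreover have "real (q + 1) * \<kappa> \<le> real (\<tau> j) * \<kappa>" using j \<kappa> by (intro mult_right_mono) (simp_all only: of_nat_le_iff)
    ultimately show ?thesis by linarith
  qed
  show "M - real q * \<kappa> \<le> real (A + q * \<eta>) * h" if q: "R < (q + 1) * N"
  proof -
    have "\<exists>j<N. \<tau> j \<le> q"
    proof (rule ccontr)
      assume "\<not> ?thesis"
      then have "(\<Sum>j<N. q + 1) \<le> (\<Sum>j<N. \<tau> j)" by (intro sum_mono) (auto simp: not_le)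
      then show False using q R by (simp add: mult.commute)
    qed
    then obtain j where j: "j < N" "\<tau> j \<le> q" by blast
    have yh: "y i j \<le> h" if "i < a" for i
      using row[OF that] member_le_sum[of j "{..<N}" "y i"] pos that j by auto
    have "real q * \<kappa> \<ge> real (\<tau> j) * \<kappa>" using j \<kappa> by (intro mult_right_mono) simp_all
    then have "M - real q * \<kappa> \<le> (\<Sum>i<a. y i j)" using col(1)[OF j(1)] by simp
    also have "\<dots> = (\<Sum>i\<in>{i \<in> {..<a}. y i j \<noteq> 0}. y i j)" by (intro sum.mono_neutral_right) auto
    also have "\<dots> \<le> card {i \<in> {..<a}. y i j \<noteq> 0} * h" using yh by (intro sum_bounded_above) auto
    also have "\<dots> \<le> real (A + q * \<eta>) * h"
    proof -
      have "card {i \<in> {..<a}. y i j \<noteq> 0} \<le> A + \<tau> j * \<eta>" by (rule col(2)[OF j(1)])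
      also have "\<dots> \<le> A + q * \<eta>" using j(2) by simp
      finally show ?thesis using h by (intro mult_right_mono) (simp_all only: of_nat_le_iff)
    qed
    finally show ?thesis .
  qed
qed

text \<open>The second alternative is only met by the muffin problem with fewer than 3/2 muffins per
  student.\<close>
definition admissible :: "nat \<Rightarrow> nat \<Rightarrow> nat \<Rightarrow> real \<Rightarrow> real \<Rightarrow> bool"
  where "admissible D e \<eta> h \<kappa> \<longleftrightarrow> e + 1 + \<eta> \<le> D * e \<and> (1 \<le> \<eta> \<or> h \<le> \<kappa> \<and> 3 \<le> D) \<or>
    D = 2 \<and> e = 1 \<and> \<eta> = 1 \<and> h < \<kappa>"

text \<open>Induction on the number of hubs and consumers. If type \<open>r\<close> is heavy and
  \<open>M1 - \<kappa> < \<kappa>\<close>, the scaled solution is contracted, the induction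
  hypothesis applied, and the result expanded. If \<open>\<kappa> \<le> M1 - \<kappa>\<close>, a
  third type might occur in the scaled solution and obstruct its contraction, but then the unscaled
  contracted problem is light and is solved outright. \<open>admissible\<close> supplies the
  inequalities for both cases and is inherited by the contraction.\<close>

lemma feasible_descale:
  fixes k a D N R A \<eta> :: nat and h M \<kappa> :: real
  assumes k: "0 < k"
  shows "feasible (k * a) h D (k * N) (k * R) M \<kappa> A \<eta> \<Longrightarrow> 0 < N \<Longrightarrow> 2 \<le> D \<Longrightarrow> 2 \<le> A + (R div N) * \<eta> \<Longrightarrow>
    0 \<le> \<kappa> \<Longrightarrow> a * D = N * A + R * \<eta> \<Longrightarrow> admissible D (A + (R div N) * \<eta> - 1) \<eta> h \<kappa> \<Longrightarrow>
    feasible a h D N R M \<kappa> A \<eta>"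
proof (induction "a + N" arbitrary: a h D N R M \<kappa> A \<eta> rule: less_induct)
  case less
  note f = less.prems(1) and N = less.prems(2) and D = less.prems(3) and A2 = less.prems(4)
    and \<kappa> = less.prems(5) and deg0 = less.prems(6) and adm0 = less.prems(7)
  define r where "r = R div N"
  define N2 where "N2 = R mod N"
  define N1 where "N1 = N - N2"
  have N2N: "N2 < N" using N by (simp add: N2_def)
  have N1: "0 < N1" and NN: "N = N1 + N2" using N2N by (auto simp: N1_def)
  have RR: "R = N1 * r + N2 * (r + 1)"
  proof -
    have "R = r * N + N2" by (simp add: r_def N2_def)
    then show ?thesis unfolding NN by (simp add: algebra_simps)
  qed
  obtain e where A: "A + r * \<eta> = e + 1" and e: "1 \<le> e"
    using A2 unfolding r_def[symmetric] by (metis Suc_eq_plus1 Suc_le_D Suc_le_mono numeral_2_eq_2 One_nat_def)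
  have adm: "admissible D e \<eta> h \<kappa>" using adm0 A by (simp add: r_def[symmetric])
  define M1 where "M1 = M - real r * \<kappa>"
  have deg: "a * D = N1 * (e + 1) + N2 * (e + 1 + \<eta>)"
  proof -
    have "N * A + R * \<eta> = N1 * (A + r * \<eta>) + N2 * (A + r * \<eta> + \<eta>)"
      unfolding NN RR by (simp add: algebra_simps)
    then show ?thesis unfolding deg0 A .
  qed
  have a: "0 < a" using deg N1 by (cases a) auto
  have ka: "0 < k * a" using k a by simp
  note bounds = feasible_bounds[OF f ka \<kappa>]
  have h: "0 \<le> h" by (rule bounds(1))
  have mass: "real a * h = real N1 * M1 + real N2 * (M1 - \<kappa>)"
  proof -
    have "real k * (real a * h) = real k * (N * M - R * \<kappa>)" using bounds(2) by (simp add: algebra_simps)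
    then have "real a * h = N * M - R * \<kappa>" using k by simp
    then show ?thesis unfolding NN RR M1_def by (simp add: algebra_simps)
  qed
  have M2: "0 \<le> M1 - \<kappa>" if "0 < N2"
  proof -
    have "r * (k * N) < k * R" using that k by (simp add: NN RR algebra_simps)
    from bounds(3)[OF this] show ?thesis by (simp add: M1_def algebra_simps)
  qed
  have M1h: "M1 \<le> (e + 1) * h"
  proof -
    have "R < (r + 1) * N" using N1 by (simp add: NN RR algebra_simps)
    then have "k * R < k * ((r + 1) * N)" using k by simp
    then have "k * R < (r + 1) * (k * N)" by (simp add: mult.left_commute)
    from bounds(4)[OF this] show ?thesis unfolding A M1_def .
  qed
  have M1: "0 \<le> M1"
  proof (cases "N2 = 0")
    case True
    then have "real a * h = N1 * M1" using mass by simp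
    moreover have "0 \<le> real a * h" using h by simp
    ultimately have "0 \<le> N1 * M1" by linarith
    then show ?thesis using N1 by (simp add: zero_le_mult_iff)
  next
    case False then show ?thesis using M2 \<kappa> by simp
  qed
  show ?case
  proof (cases "M1 \<le> e * h")
    case True
    show ?thesis unfolding NN RR
      by (rule feasible_light[OF N1 D e A \<kappa> deg mass M1_def[symmetric] M1 M2 True])
  next
    case False
    then have heavy: "e * h < M1" by simp
    \<comment> \<open>If all consumers had type \<open>r\<close>, the degrees would give
      \<open>a \<le> N1 * e\<close>, too few hubs for consumers of mass above
      \<open>e * h\<close>.\<close>
    have N2: "0 < N2"
    proof (rule ccontr)
      assume "\<not> 0 < N2"
      then have 0: "real a * h = N1 * M1" "a * D = N1 * (e + 1)" using mass deg by auto
      have "2 * a \<le> D * a" using D by simp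
      also have "\<dots> \<le> N1 * (2 * e)" using 0(2) e by (simp add: mult.commute)
      finally have "real a \<le> real (N1 * e)" by (simp only: of_nat_le_iff)
      then have "real a * h \<le> real (N1 * e) * h" using h by (rule mult_right_mono)
      then have "N1 * M1 \<le> N1 * (e * h)" using 0(1) by (simp add: mult.assoc)
      then show False using heavy N1 by simp
    qed
    define A2' where "A2' = e + 1 + \<eta>"
    define \<kappa>' where "\<kappa>' = M1 - e * h"
    define m2 where "m2 = M1 - \<kappa>"
    have m2: "0 \<le> m2" using M2[OF N2] by (simp add: m2_def)
    have \<kappa>': "0 < \<kappa>'" "\<kappa>' \<le> h" using heavy M1h by (auto simp: \<kappa>'_def algebra_simps)
    have hpos: "0 < h" using \<kappa>' by simp
    have "real N1 * (e * h) < real N1 * M1" using heavy N1 by simp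
    also have "\<dots> \<le> real a * h" using mass m2 by (simp add: m2_def)
    finally have "real (N1 * e) * h < real a * h" by (simp add: mult.assoc)
    then have "real (N1 * e) < real a" using hpos by (simp add: mult_less_cancel_right)
    then have Na: "N1 * e < a" by (simp only: of_nat_less_iff)
    define N' where "N' = a - N1 * e"
    have N': "0 < N'" "a = N' + N1 * e" using Na by (auto simp: N'_def)
    define \<eta>' where "\<eta>' = e * D - (e + 1)"
    have eD: "2 * e \<le> e * D" using D by simp
    have \<eta>': "\<eta>' + (e + 1) = e * D"
    proof -
      have "e + 1 \<le> e * D" using eD e by linarith
      then show ?thesis unfolding \<eta>'_def by (rule le_add_diff_inverse2)
    qed
    have deg': "N2 * A2' = N' * D + N1 * \<eta>'"
    proof -
      have "N1 * (\<eta>' + (e + 1)) = N1 * (e * D)" unfolding \<eta>' ..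
      moreover have "(N' + N1 * e) * D = N1 * (e + 1) + N2 * A2'"
        using deg N'(2) by (simp add: A2'_def)
      ultimately show ?thesis by (simp add: algebra_simps)
    qed
    have mass': "real N2 * m2 = real N' * h - real N1 * \<kappa>'"
      using mass N'(2) by (simp add: m2_def \<kappa>'_def algebra_simps)
    have child: "feasible N2 m2 A2' N' N1 h \<kappa>' D \<eta>' \<Longrightarrow> feasible a h D N R M \<kappa> A \<eta>"
    proof (erule feasible_expand[OF _ less_imp_le[OF \<kappa>'(1)] e D \<eta>' N'(2) _ _ _ _ A])
      show "N = N2 + N1" "R = N2 * (r + 1) + N1 * r" using NN RR by auto
      show "M - real r * \<kappa> = \<kappa>' + e * h" by (simp add: \<kappa>'_def M1_def)
      show "m2 = M - real (r + 1) * \<kappa>" by (simp add: m2_def M1_def algebra_simps)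
      show "A2' = A + (r + 1) * \<eta>" using A by (simp add: A2'_def)
    qed
    define q where "q = N1 div N'"
    have A2'_2: "2 \<le> A2'" using e by (simp add: A2'_def)
    have D\<eta>': "D + \<eta>' = (D - 1) * (e + 1)"
    proof -
      obtain D' where "D = D' + 1" using D by (metis add.commute le_Suc_ex one_le_numeral order_trans)
      then show ?thesis using \<eta>' by (simp add: algebra_simps)
    qed
    show ?thesis
    proof (cases "m2 < \<kappa>")
      case True
      have "1 \<le> \<eta> \<or> h \<le> \<kappa>" using adm by (auto simp: admissible_def)
      then have kchild: "feasible (k * N2) m2 A2' (k * N') (k * N1) h \<kappa>' D \<eta>'"
        unfolding m2_def A2'_def \<kappa>'_def
        using feasible_contract[OF f[unfolded NN RR] A M1_def[symmetric] h \<kappa> heavy _ _ N'(2) \<eta>'] True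
        by (simp add: m2_def)
      \<comment> \<open>Contraction removes \<open>N1\<close> consumers and \<open>N1 * e\<close>
        hubs; the remaining consumers become the hubs and the trees the consumers.\<close>
      have smaller: "N2 + N' < a + N"
      proof -
        have "N1 \<le> N1 * e" using e by simp
        then show ?thesis using N'(2) NN N1 by linarith
      qed
      have adm': "admissible A2' (D + (N1 div N') * \<eta>' - 1) \<eta>' m2 \<kappa>'"
      proof -
        have "D + q * \<eta>' + \<eta>' \<le> A2' * (D + q * \<eta>' - 1)"
        proof (cases "q = 0")
          case True
          then have "D + q * \<eta>' + \<eta>' = (e + 1) * (D - 1)" using D\<eta>' by (simp add: mult.commute)
          also have "\<dots> \<le> A2' * (D - 1)" unfolding A2'_def by (rule mult_le_mono1) simp
          finally show ?thesis using True by simp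
        next
          case False
          then have "\<eta>' \<le> q * \<eta>'" by simp
          then have "D + q * \<eta>' + \<eta>' \<le> 2 * (D + q * \<eta>' - 1)" using D by linarith
          also have "\<dots> \<le> A2' * (D + q * \<eta>' - 1)" using A2'_2 by (rule mult_le_mono1)
          finally show ?thesis .
        qed
        \<comment> \<open>In the exceptional alternative \<open>\<eta>' = 0\<close>, but there
          \<open>m2 = M1 - \<kappa>\<close> lies below \<open>\<kappa>' = M1 - h\<close> and
          \<open>A2' = 3\<close>; this is what the clause
          \<open>h \<le> \<kappa> \<and> 3 \<le> D\<close> of \<open>admissible\<close> provides
          for.\<close>
        moreover have "1 \<le> \<eta>' \<or> m2 \<le> \<kappa>' \<and> 3 \<le> A2'"
        proof (cases "D = 2 \<and> e = 1 \<and> \<eta> = 1 \<and> h < \<kappa>")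
          case True
          then show ?thesis by (auto simp: m2_def \<kappa>'_def A2'_def)
        next
          case False
          then have ad: "e + 1 + \<eta> \<le> D * e" "1 \<le> \<eta> \<or> 3 \<le> D" using adm by (auto simp: admissible_def)
          have "1 \<le> \<eta>'"
          proof (cases "1 \<le> \<eta>")
            case True then show ?thesis using ad(1) \<eta>' by (simp add: mult.commute)
          next
            case False
            then have "e * 3 \<le> e * D" using ad(2) by simp
            then show ?thesis using \<eta>' e by linarith
          qed
          then show ?thesis ..
        qed
        ultimately show ?thesis using D unfolding admissible_def q_def[symmetric] by simp
      qed
      have "feasible N2 m2 A2' N' N1 h \<kappa>' D \<eta>'"
        by (rule less.hyps[OF smaller kchild N'(1) A2'_2 _ _ deg' adm']) (use D \<kappa>' in auto)
      then show ?thesis by (rule child)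
    next
      case False
      then have m2\<kappa>: "\<kappa> \<le> m2" by simp
      \<comment> \<open>The exceptional alternative would give
        \<open>M1 \<le> 2 * h < 2 * \<kappa>\<close>, against
        \<open>\<kappa> \<le> m2\<close>.\<close>
      have nsp: "\<not> (D = 2 \<and> e = 1 \<and> \<eta> = 1 \<and> h < \<kappa>)"
        using M1h m2\<kappa> by (auto simp: m2_def)
      then have ad: "e + 1 + \<eta> \<le> D * e" "1 \<le> \<eta> \<or> 3 \<le> D" using adm by (auto simp: admissible_def)
      have M1m2: "M1 \<le> 2 * m2" using m2\<kappa> by (simp add: m2_def)
      have De: "2 \<le> (D - 1) * e"
      proof (cases "3 \<le> D")
        case True
        then have "2 * 1 \<le> (D - 1) * e" using e by (intro mult_le_mono) auto
        then show ?thesis by simp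
      next
        case False
        then have "D = 2" "1 \<le> \<eta>" using D ad by auto
        then show ?thesis using ad(1) by simp
      qed
      have qN: "q * N' \<le> N1" by (simp add: q_def)
      \<comment> \<open>Even a tree with \<open>q + 1\<close> heavy consumers must have nonnegative
        mass. For \<open>q > 0\<close> it suffices that \<open>N' * \<kappa>' \<le> N2 * m2\<close>,
        because \<open>N1 * \<kappa>' + N2 * m2 = N' * h\<close> and \<open>q * N' \<le> N1\<close>.
        That inequality combines the degree bound \<open>2 * N' \<le> (1 + 2 * e) * N2\<close> with
        \<open>\<kappa>' \<le> 2 * m2 - e * h\<close>.\<close>
      have nn: "(real q + 1) * \<kappa>' \<le> h"
      proof (cases "q = 0")
        case True then show ?thesis using \<kappa>' by simp
      next
        case False
        then have N'N1: "N' \<le> N1" using qN by (metis le_trans mult_le_mono1 nat_mult_1 Suc_leI neq0_conv One_nat_def)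
        have "(D - 1) * (e + 1) * N' \<le> N2 * A2'"
        proof -
          have "\<eta>' * N' \<le> \<eta>' * N1" using N'N1 by simp
          then have "(D + \<eta>') * N' \<le> N2 * A2'" unfolding deg' by (simp add: algebra_simps)
          then show ?thesis unfolding D\<eta>' .
        qed
        also have "\<dots> \<le> N2 * (D * e)" using ad(1) unfolding A2'_def by (rule mult_le_mono2)
        finally have X: "(D - 1) * ((e + 1) * N') \<le> N2 * (D * e)" by (simp only: mult.assoc)
        have "D * ((e + 1) * N') \<le> 2 * (D - 1) * ((e + 1) * N')"
          using D by (intro mult_le_mono1) linarith
        also have "\<dots> = 2 * ((D - 1) * ((e + 1) * N'))" by (simp only: mult.assoc)
        also have "\<dots> \<le> 2 * (N2 * (D * e))" using X by (rule mult_le_mono2)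
        also have "\<dots> = D * (2 * e * N2)" by (simp only: mult_ac)
        finally have "(e + 1) * N' \<le> 2 * e * N2" using D by simp
        moreover have "2 * N' \<le> (e + 1) * N'" using e by (intro mult_le_mono1) simp
        moreover have "2 * e * N2 \<le> (1 + 2 * e) * N2" by simp
        ultimately have n: "2 * N' \<le> (1 + 2 * e) * N2" by linarith
        have N'h: "real N' * h = real N1 * \<kappa>' + real N2 * m2" using mass' by simp
        have "real N' * \<kappa>' \<le> real N1 * \<kappa>'" using N'N1 \<kappa>' by simp
        then have "real N' * \<kappa>' + real N2 * m2 \<le> real N' * h" using N'h by simp
        \<comment> \<open>The factor \<open>e\<close> makes \<open>h\<close> cancel against the
          bound that follows.\<close>
        then have "e * (real N' * \<kappa>' + real N2 * m2) \<le> e * (real N' * h)" by (intro mult_left_mono) auto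
        moreover have "real N' * \<kappa>' \<le> real N' * (2 * m2 - e * h)"
          using M1m2 by (intro mult_left_mono) (auto simp: \<kappa>'_def)
        ultimately have "(1 + real e) * (real N' * \<kappa>') \<le> (2 * real N' - e * real N2) * m2"
          by (simp add: algebra_simps)
        also have "\<dots> \<le> ((1 + real e) * real N2) * m2"
        proof (rule mult_right_mono[OF _ m2])
          have "real (2 * N') \<le> real ((1 + 2 * e) * N2)" using n by (simp only: of_nat_le_iff)
          then show "2 * real N' - e * real N2 \<le> (1 + real e) * real N2" by (simp add: algebra_simps)
        qed
        finally have "(1 + real e) * (real N' * \<kappa>') \<le> (1 + real e) * (real N2 * m2)" by (simp add: mult.assoc)
        then have "real N' * \<kappa>' \<le> real N2 * m2" by (simp add: mult_le_cancel_left_pos)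
        moreover have "real (q * N') * \<kappa>' \<le> real N1 * \<kappa>'"
          using qN \<kappa>' by (intro mult_right_mono) (simp_all only: of_nat_le_iff less_imp_le)
        ultimately have "real N' * ((real q + 1) * \<kappa>') \<le> real N' * h"
          using N'h by (simp add: algebra_simps)
        then show ?thesis using N'(1) by (simp add: mult_le_cancel_left_pos)
      qed
      define n2 where "n2 = N1 mod N'"
      define n1 where "n1 = N' - n2"
      have n2: "n2 < N'" using N' by (simp add: n2_def)
      have n1: "0 < n1" and N'n: "N' = n1 + n2" using n2 by (auto simp: n1_def)
      have N1n: "N1 = n1 * q + n2 * (q + 1)"
      proof -
        have "N1 = q * N' + n2" by (simp add: q_def n2_def)
        then show ?thesis unfolding N'n by (simp add: algebra_simps)
      qed
      define e' where "e' = D + q * \<eta>' - 1"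
      have e': "D + q * \<eta>' = e' + 1" "1 \<le> e'" using D by (auto simp: e'_def)
      have "feasible N2 m2 A2' (n1 + n2) (n1 * q + n2 * (q + 1)) h \<kappa>' D \<eta>'"
      proof (rule feasible_light[OF n1 A2'_2 e'(2,1) less_imp_le[OF \<kappa>'(1)] _ _ refl])
        show "N2 * A2' = n1 * (e' + 1) + n2 * (e' + 1 + \<eta>')"
          unfolding deg' e'(1)[symmetric] N'n N1n by (simp add: algebra_simps)
        show "real N2 * m2 = real n1 * (h - real q * \<kappa>') + real n2 * (h - real q * \<kappa>' - \<kappa>')"
          unfolding mass' N'n N1n by (simp add: algebra_simps)
        show "0 \<le> h - real q * \<kappa>'" using nn \<kappa>' by (simp add: algebra_simps)
        show "0 \<le> h - real q * \<kappa>' - \<kappa>'" using nn by (simp add: algebra_simps)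
        \<comment> \<open>Lightness of the contraction: \<open>e * h < M1 \<le> 2 * m2\<close> and
          \<open>2 \<le> (D - 1) * e\<close> give \<open>h \<le> (D - 1) * m2\<close>, and
          \<open>D - 1 \<le> e'\<close>.\<close>
        have 1: "real (D - 1) * (e * h) \<le> real (D - 1) * (2 * m2)"
          using heavy M1m2 by (intro mult_left_mono) auto
        have "real 2 \<le> real ((D - 1) * e)" using De by (simp only: of_nat_le_iff)
        from mult_right_mono[OF this h] have "2 * h \<le> real (D - 1) * (e * h)" by (simp add: mult.assoc)
        then have "h \<le> real (D - 1) * m2" using 1 by linarith
        also have "\<dots> \<le> e' * m2" using m2 by (intro mult_right_mono) (auto simp: e'_def)
        finally show "h - real q * \<kappa>' \<le> e' * m2" using \<kappa>'(1) mult_nonneg_nonneg[of "real q" \<kappa>'] by linarith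
      qed
      then show ?thesis unfolding N'n[symmetric] N1n[symmetric] by (rule child)
    qed
  qed
qed

section \<open>Muffin divisions\<close>

text \<open>Pieces of one muffin that go to the same student may be merged, so a division is just a
  matrix of shares.\<close>
definition share_matrix :: "nat \<Rightarrow> nat \<Rightarrow> real \<Rightarrow> (nat \<Rightarrow> nat \<Rightarrow> real) \<Rightarrow> bool"
  where "share_matrix m s \<alpha> z \<longleftrightarrow>
    (\<forall>i<m. \<forall>j<s. z i j = 0 \<or> \<alpha> \<le> z i j) \<and>
    (\<forall>i<m. (\<Sum>j<s. z i j) = 1) \<and> (\<forall>j<s. (\<Sum>i<m. z i j) = real m / real s)"

lemma sum_list_partition:
  fixes w :: "'a \<Rightarrow> real"
  assumes "finite B" "\<And>p. p \<in> set P \<Longrightarrow> g p \<in> B"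
  shows "(\<Sum>b\<in>B. sum_list (map w (filter (\<lambda>p. Q p \<and> g p = b) P))) = sum_list (map w (filter Q P))"
  using assms(2)
proof (induction P)
  case (Cons p P)
  have "sum_list (map w (filter (\<lambda>p. Q p \<and> g p = b) (p # P))) =
      (if g p = b then (if Q p then w p else 0) else 0) + sum_list (map w (filter (\<lambda>p. Q p \<and> g p = b) P))" for b
    by simp
  then have "(\<Sum>b\<in>B. sum_list (map w (filter (\<lambda>p. Q p \<and> g p = b) (p # P)))) =
      (if Q p then w p else 0) + sum_list (map w (filter Q P))"
    using Cons assms(1) by (simp add: sum.distrib del: filter.simps)
  then show ?case by simp
qed simp

lemma division_share_matrix:
  assumes P: "muffin_division m s P" and \<alpha>: "\<And>i j x. (i, j, x) \<in> set P \<Longrightarrow> \<alpha> \<le> x"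
  shows "\<exists>z. share_matrix m s \<alpha> z"
proof -
  define w where "w = (\<lambda>(i :: nat, j :: nat, x :: real). x)"
  define z where "z = (\<lambda>i j. sum_list (map w (filter (\<lambda>p. fst p = i \<and> fst (snd p) = j) P)))"
  have P1: "i < m \<and> j < s \<and> 0 < x" if "(i, j, x) \<in> set P" for i j x
    using P that unfolding muffin_division_def by blast
  have row: "sum_list (map w (filter (\<lambda>p. fst p = i) P)) = 1" if "i < m" for i
    using P that unfolding muffin_division_def w_def by (simp add: case_prod_unfold)
  have col: "sum_list (map w (filter (\<lambda>p. fst (snd p) = j) P)) = real m / real s" if "j < s" for j
    using P that unfolding muffin_division_def w_def by (simp add: case_prod_unfold)
  \<comment> \<open>Merging pieces only increases their size, and an absent piece becomes the entry
    0.\<close>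
  have ge: "xs = [] \<or> \<alpha> \<le> sum_list (map w xs)" if "set xs \<subseteq> set P" for xs
  proof (cases xs)
    case (Cons p ps)
    obtain i j x where p: "p = (i, j, x)" by (cases p)
    have "0 \<le> sum_list (map w ps)"
      using that Cons P1 by (intro sum_list_nonneg) (force simp: w_def)
    moreover have "\<alpha> \<le> w p" using that Cons p \<alpha>[of i j x] by (auto simp: w_def)
    ultimately show ?thesis using Cons by simp
  qed simp
  have "share_matrix m s \<alpha> z"
    unfolding share_matrix_def
  proof (intro conjI allI impI)
    fix i j
    show "z i j = 0 \<or> \<alpha> \<le> z i j"
      using ge[of "filter (\<lambda>p. fst p = i \<and> fst (snd p) = j) P"] by (auto simp: z_def)
  next
    fix i assume i: "i < m"
    have "(\<Sum>j<s. z i j) = sum_list (map w (filter (\<lambda>p. fst p = i) P))"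
      unfolding z_def by (rule sum_list_partition) (use P1 in auto)
    then show "(\<Sum>j<s. z i j) = 1" using row[OF i] by simp
  next
    fix j assume j: "j < s"
    have "(\<Sum>i<m. sum_list (map w (filter (\<lambda>p. fst (snd p) = j \<and> fst p = i) P))) =
        sum_list (map w (filter (\<lambda>p. fst (snd p) = j) P))"
      by (rule sum_list_partition) (use P1 in auto)
    then show "(\<Sum>i<m. z i j) = real m / real s" using col[OF j] by (simp add: z_def conj_commute)
  qed
  then show ?thesis by blast
qed

lemma share_matrix_division:
  assumes z: "share_matrix m s \<alpha> z" and \<alpha>: "0 < \<alpha>"
  shows "\<exists>P. muffin_division m s P \<and> (\<forall>(i, j, x)\<in>set P. \<alpha> \<le> x)"
proof -
  define Q where "Q = filter (\<lambda>(i, j). z i j \<noteq> 0) (List.product [0..<m] [0..<s])"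
  define P where "P = map (\<lambda>(i, j). (i, j, z i j)) Q"
  have Q: "distinct Q" "set Q = {(i, j). i < m \<and> j < s \<and> z i j \<noteq> 0}"
    by (auto simp: Q_def distinct_product)
  have ge: "\<alpha> \<le> z i j" if "i < m" "j < s" "z i j \<noteq> 0" for i j
    using z that unfolding share_matrix_def by blast
  have sumQ: "sum_list (map (\<lambda>(i, j, x). x) (filter R P)) =
      (\<Sum>(i, j)\<in>{(i, j). i < m \<and> j < s \<and> R (i, j, z i j)}. z i j)" for R
  proof -
    have "map (\<lambda>(i, j, x). x) (filter R P) = map (\<lambda>(i, j). z i j) (filter (\<lambda>(i, j). R (i, j, z i j)) Q)"
      by (simp add: P_def filter_map comp_def case_prod_unfold)
    then have "sum_list (map (\<lambda>(i, j, x). x) (filter R P)) =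
        (\<Sum>(i, j)\<in>set (filter (\<lambda>(i, j). R (i, j, z i j)) Q). z i j)"
      using Q(1) by (simp add: sum_list_distinct_conv_sum_set)
    also have "\<dots> = (\<Sum>(i, j)\<in>{(i, j). i < m \<and> j < s \<and> R (i, j, z i j)}. z i j)"
    proof (rule sum.mono_neutral_left)
      show "finite {(i, j). i < m \<and> j < s \<and> R (i, j, z i j)}"
        by (rule finite_subset[of _ "{..<m} \<times> {..<s}"]) auto
    qed (auto simp: Q(2))
    finally show ?thesis .
  qed
  have "sum_list (map (\<lambda>(i', j, x). x) (filter (\<lambda>(i', j, x). i' = i) P)) = 1" if i: "i < m" for i
  proof -
    have "{(i', j). i' < m \<and> j < s \<and> i' = i} = Pair i ` {..<s}" using i by auto
    then have "sum_list (map (\<lambda>(i', j, x). x) (filter (\<lambda>(i', j, x). i' = i) P)) = (\<Sum>j<s. z i j)"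
      by (simp add: sumQ sum.reindex inj_on_def)
    then show ?thesis using z i by (simp add: share_matrix_def)
  qed
  moreover have "sum_list (map (\<lambda>(i, j', x). x) (filter (\<lambda>(i, j', x). j' = j) P)) = real m / real s"
    if j: "j < s" for j
  proof -
    have "{(i, j'). i < m \<and> j' < s \<and> j' = j} = (\<lambda>i. (i, j)) ` {..<m}" using j by auto
    then have "sum_list (map (\<lambda>(i, j', x). x) (filter (\<lambda>(i, j', x). j' = j) P)) = (\<Sum>i<m. z i j)"
      by (simp add: sumQ sum.reindex inj_on_def)
    then show ?thesis using z j by (simp add: share_matrix_def)
  qed
  moreover have "\<forall>(i, j, x)\<in>set P. i < m \<and> j < s \<and> 0 < x \<and> \<alpha> \<le> x"
    using ge \<alpha> by (fastforce simp: P_def Q(2))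
  ultimately have "muffin_division m s P \<and> (\<forall>(i, j, x)\<in>set P. \<alpha> \<le> x)"
    unfolding muffin_division_def by fast
  then show ?thesis by blast
qed

section \<open>Explicit share matrices\<close>

lemma share_matrix_copies:
  assumes z: "share_matrix m s \<alpha> z" and "0 < k" "0 < s" "0 < m"
  shows "\<exists>z. share_matrix (k * m) (k * s) \<alpha> z"
proof -
  define z' where "z' = (\<lambda>i j. if i div m = j div s then z (i mod m) (j mod s) else 0)"
  have blocks: "(\<Sum>j<k * n. if j div n = b then f (j mod n) else 0) = (\<Sum>j<n. f j)"
    if "0 < n" "b < k" for n b and f :: "nat \<Rightarrow> real"
  proof -
    have "(\<Sum>j<k * n. if j div n = b then f (j mod n) else 0) = (\<Sum>j\<in>(\<lambda>j. b * n + j) ` {..<n}. f (j mod n))"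
    proof (rule sum.mono_neutral_cong_right)
      show "(\<lambda>j. b * n + j) ` {..<n} \<subseteq> {..<k * n}"
      proof (intro image_subsetI)
        fix j assume "j \<in> {..<n}"
        moreover have "(b + 1) * n \<le> k * n" using that by (intro mult_le_mono1) simp
        ultimately show "b * n + j \<in> {..<k * n}" by simp
      qed
      have "j \<in> (\<lambda>j. b * n + j) ` {..<n}" if "j div n = b" for j
        using that \<open>0 < n\<close> by (intro image_eqI[of _ _ "j mod n"]) (auto simp: mult.commute)
      then show "\<forall>j\<in>{..<k * n} - (\<lambda>j. b * n + j) ` {..<n}. (if j div n = b then f (j mod n) else 0) = 0" by auto
    qed auto
    also have "\<dots> = (\<Sum>j<n. f j)" by (simp add: sum.reindex inj_on_def)
    finally show ?thesis .
  qed
  have dv: "i div n < k" "i mod n < n" if "i < k * n" "0 < n" for i n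
    using that by (simp_all add: less_mult_imp_div_less)
  have "share_matrix (k * m) (k * s) \<alpha> z'"
    unfolding share_matrix_def
  proof (intro conjI allI impI)
    fix i j assume "i < k * m" "j < k * s"
    then show "z' i j = 0 \<or> \<alpha> \<le> z' i j" using z dv assms unfolding share_matrix_def z'_def by auto
  next
    fix i assume i: "i < k * m"
    have "(\<Sum>j<k * s. z' i j) = (\<Sum>j<k * s. if j div s = i div m then z (i mod m) (j mod s) else 0)"
      unfolding z'_def by (intro sum.cong) auto
    also have "\<dots> = 1" using blocks[of s "i div m"] dv[OF i] assms z by (simp add: share_matrix_def)
    finally show "(\<Sum>j<k * s. z' i j) = 1" .
  next
    fix j assume j: "j < k * s"
    have "(\<Sum>i<k * m. z' i j) = real m / real s"
      using blocks[of m "j div s" "\<lambda>i. z i (j mod s)"] dv[OF j] assms z by (simp add: share_matrix_def z'_def)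
    then show "(\<Sum>i<k * m. z' i j) = real (k * m) / real (k * s)" using assms by simp
  qed
  then show ?thesis by blast
qed

lemma share_matrix_whole:
  assumes "0 < s" "s dvd m" "0 < m"
  shows "\<exists>z. share_matrix m s 1 z"
proof -
  obtain t where t: "m = s * t" using assms by auto
  then have t0: "0 < t" using assms by (cases t) auto
  define z where "z = (\<lambda>i j. if i div t = j then 1 else 0 :: real)"
  have "share_matrix m s 1 z"
    unfolding share_matrix_def
  proof (intro conjI allI impI)
    fix i assume "i < m"
    then have "i div t < s" using t by (simp add: less_mult_imp_div_less)
    then show "(\<Sum>j<s. z i j) = 1" by (simp add: z_def)
  next
    fix j assume j: "j < s"
    have "(j + 1) * t \<le> m" unfolding t using j by (intro mult_le_mono1) simp
    then have "{i \<in> {..<m}. i div t = j} = {j * t..<j * t + t}"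
      using t0 by (auto simp: div_eq_iff_interval)
    then have "(\<Sum>i<m. z i j) = real t" by (simp add: z_def sum.If_cases Int_def)
    then show "(\<Sum>i<m. z i j) = real m / real s" using t assms by simp
  qed (auto simp: z_def)
  then show ?thesis by blast
qed

text \<open>Seat the students in a circle; neighbours share one muffin, cut in the middle third, and the
  remaining muffins are cut in thirds. Each student takes as many thirds as are needed to keep the
  next cut in the middle third. The circle closes because the cuts change by \<open>m - s\<close> minus a number
  of thirds over a full round, and the first cut is at 1/2.\<close>
lemma share_matrix_thirds:
  assumes s: "0 < s" and ms: "s \<le> m"
  shows "\<exists>z. share_matrix m s (1 / 3) z"
proof -
  \<comment> \<open>\<open>G i\<close> is \<open>3 * i * (m - s) / s\<close> rounded to the nearest
    integer, the summand \<open>s\<close> being the half. It counts the thirds handed out before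
    student \<open>i\<close>; a rounding error of at most half a third keeps \<open>x i\<close>
    within 1/6 of 1/2.\<close>
  define G where "G = (\<lambda>i. (6 * i * (m - s) + s) div (2 * s))"
  define x where "x = (\<lambda>i. 1 / 2 + real i * (m - s) / s - real (G i) / 3)"
  have G0: "G 0 = 0" using s by (simp add: G_def)
  have Gs: "G s = 3 * (m - s)"
  proof -
    have "6 * s * (m - s) + s = s + (3 * (m - s)) * (2 * s)" by simp
    then have "G s = s div (2 * s) + 3 * (m - s)" unfolding G_def using s by (simp only: div_mult_self1)
    then show ?thesis using s by simp
  qed
  have Gmono: "G j \<le> G (Suc j)" for j unfolding G_def by (intro div_le_mono) simp
  have x01: "1 / 3 \<le> x i" "x i \<le> 2 / 3" for i
  proof -
    define a where "a = 6 * i * (m - s) + s"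
    have "G i * (2 * s) \<le> a" "a < G i * (2 * s) + 2 * s"
      using div_eq_iff_interval[of "2 * s" a "G i"] s by (auto simp: G_def a_def)
    then have b: "real (G i * (2 * s)) \<le> real a" "real a < real (G i * (2 * s) + 2 * s)"
      by (simp_all only: of_nat_le_iff of_nat_less_iff)
    define c where "c = real i * real (m - s) / s"
    have "real a = (6 * c + 1) * s" using s by (simp add: a_def c_def distrib_right)
    with b have "real (G i) * 2 * s \<le> (6 * c + 1) * s" "(6 * c + 1) * s < (real (G i) * 2 + 2) * s"
      by (simp_all add: algebra_simps)
    then have "real (G i) * 2 \<le> 6 * c + 1" "6 * c + 1 < real (G i) * 2 + 2" using s by simp_all
    then show "1 / 3 \<le> x i" "x i \<le> 2 / 3" by (simp_all add: x_def c_def)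
  qed
  have xs: "x s = x 0" using s by (simp add: x_def G0 Gs)
  define nxt where "nxt = (\<lambda>j. if Suc j = s then 0 else Suc j)"
  have xn: "x (nxt j) = x (Suc j)" for j using xs by (auto simp: nxt_def)
  have nxt: "nxt j < s" if "j < s" for j using that by (auto simp: nxt_def)
  have nxt1: "(\<Sum>j<s. if nxt j = i then c else 0) = c" if "i < s" for i and c :: real
  proof -
    have "{j \<in> {..<s}. nxt j = i} = {if i = 0 then s - 1 else i - 1}"
      using that by (auto simp: nxt_def split: if_splits)
    then show ?thesis by (simp add: sum.If_cases Int_def)
  qed
  define T where "T = (\<lambda>j X. card {t \<in> X. G j \<le> t \<and> t < G (Suc j)})"
  \<comment> \<open>Student \<open>j\<close> gets \<open>1 - x j\<close> of muffin \<open>j\<close>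
    and the complementary kind of part of the next muffin on the circle; for \<open>s = 1\<close>
    the two summands add up to one whole muffin. The thirds of the muffins from \<open>s\<close> on
    are numbered consecutively, and student \<open>j\<close> takes those from \<open>G j\<close> up
    to but excluding \<open>G (Suc j)\<close>.\<close>
  define z where "z = (\<lambda>i j. if i < s then (if j = i then 1 - x i else 0) + (if nxt j = i then x i else 0)
    else real (T j {3 * (i - s)..<3 * (i - s) + 3}) / 3)"
  have tel: "(\<Sum>j<n. T j X) = card {t \<in> X. t < G n}" if "finite X" for n X
  proof (induction n)
    case (Suc n)
    have "{t \<in> X. t < G (Suc n)} = {t \<in> X. t < G n} \<union> {t \<in> X. G n \<le> t \<and> t < G (Suc n)}"
      using Gmono[of n] by auto
    then have "card {t \<in> X. t < G (Suc n)} = card {t \<in> X. t < G n} + T n X"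
      unfolding T_def using that by (simp add: card_Un_disjoint disjoint_iff)
    then show ?case using Suc by simp
  qed (simp add: G0)
  have Tcol: "(\<Sum>u<m - s. T j {3 * u..<3 * u + 3}) = G (Suc j) - G j" if "j < s" for j
  proof -
    have "G (Suc j) \<le> G s" by (rule lift_Suc_mono_le[of G, OF Gmono]) (use that in simp)
    then have sub: "{G j..<G (Suc j)} \<subseteq> {..<3 * (m - s)}" using Gs by auto
    have "T j {3 * u..<3 * u + 3} = card {t \<in> {G j..<G (Suc j)}. t div 3 = u}" for u
      unfolding T_def by (rule arg_cong[of _ _ card]) (auto simp: div_eq_iff_interval mult.commute)
    then have "(\<Sum>u<m - s. T j {3 * u..<3 * u + 3}) = (\<Sum>u<m - s. card {t \<in> {G j..<G (Suc j)}. t div 3 = u})"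
      by (rule sum.cong[OF refl])
    also have "\<dots> = card {G j..<G (Suc j)}"
    proof (rule card_eq_sum_fibres)
      have "t div 3 < m - s" if "t \<in> {G j..<G (Suc j)}" for t
      proof -
        have "t < (m - s) * 3" using that sub by (auto simp: mult.commute)
        then show ?thesis by (rule less_mult_imp_div_less)
      qed
      then show "(\<lambda>t. t div 3) ` {G j..<G (Suc j)} \<subseteq> {..<m - s}" by auto
    qed auto
    finally have "(\<Sum>u<m - s. T j {3 * u..<3 * u + 3}) = card {G j..<G (Suc j)}" .
    then show ?thesis by simp
  qed
  have split: "(\<Sum>i<m. f i) = (\<Sum>i<s. f i) + (\<Sum>u<m - s. f (s + u))" for f :: "nat \<Rightarrow> real"
  proof -
    have "(\<Sum>i<s + n. f i) = (\<Sum>i<s. f i) + (\<Sum>u<n. f (s + u))" for n by (induction n) simp_all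
    then show ?thesis using ms by (metis le_add_diff_inverse)
  qed
  have "share_matrix m s (1 / 3) z"
    unfolding share_matrix_def
  proof (intro conjI allI impI)
    fix i j
    show "z i j = 0 \<or> 1 / 3 \<le> z i j" using x01[of i] by (auto simp: z_def)
  next
    fix i assume i: "i < m"
    show "(\<Sum>j<s. z i j) = 1"
    proof (cases "i < s")
      case True
      then show ?thesis using nxt1[OF True] by (simp add: z_def sum.distrib)
    next
      case False
      define u where "u = i - s"
      have "(\<Sum>j<s. z i j) = real (\<Sum>j<s. T j {3 * u..<3 * u + 3}) / 3"
        using False by (simp add: z_def u_def sum_divide_distrib)
      also have "{t \<in> {3 * u..<3 * u + 3}. t < G s} = {3 * u..<3 * u + 3}"
        using False i by (auto simp: Gs u_def)
      then have "(\<Sum>j<s. T j {3 * u..<3 * u + 3}) = 3" by (simp add: tel)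
      finally show ?thesis by simp
    qed
  next
    fix j assume j: "j < s"
    have "(\<Sum>i<s. z i j) = 1 - x j + x (Suc j)"
      using j nxt[OF j] by (simp add: z_def sum.distrib xn)
    moreover have "(\<Sum>u<m - s. z (s + u) j) = real (\<Sum>u<m - s. T j {3 * u..<3 * u + 3}) / 3"
      by (simp add: z_def sum_divide_distrib)
    then have "(\<Sum>u<m - s. z (s + u) j) = (real (G (Suc j)) - real (G j)) / 3"
      using Tcol[OF j] Gmono[of j] by (simp add: of_nat_diff)
    ultimately have "(\<Sum>i<m. z i j) = 1 - x j + x (Suc j) + (real (G (Suc j)) - real (G j)) / 3"
      by (simp add: split)
    also have "\<dots> = 1 + real (m - s) / s" by (simp add: x_def distrib_right add_divide_distrib diff_divide_distrib)
    also have "\<dots> = real m / real s" using s ms by (simp add: of_nat_diff field_simps)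
    finally show "(\<Sum>i<m. z i j) = real m / real s" .
  qed
  then show ?thesis by blast
qed

text \<open>Two nonzero shares of one muffin would exceed 1, so every share is 0 or 1 and
  \<open>m / s\<close> counts whole muffins.\<close>

lemma large_shares_whole:
  assumes z: "share_matrix m s \<alpha> z" and \<alpha>: "1 / 2 < \<alpha>" and s: "0 < s"
  shows "s dvd m"
proof -
  have ge: "z i j = 0 \<or> \<alpha> \<le> z i j" if "i < m" "j < s" for i j
    using z that unfolding share_matrix_def by blast
  have z0: "0 \<le> z i j" if "i < m" "j < s" for i j using ge[OF that] \<alpha> by auto
  have one: "z i j = 0 \<or> z i j = 1" if i: "i < m" and j: "j < s" for i j
  proof (cases "z i j = 0")
    case False
    have row: "1 = z i j + (\<Sum>j'\<in>{..<s} - {j}. z i j')"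
      using z i j by (simp add: share_matrix_def sum.remove[symmetric])
    have "z i j' = 0" if "j' \<in> {..<s} - {j}" for j'
    proof (rule ccontr)
      assume "z i j' \<noteq> 0"
      then have "\<alpha> \<le> z i j'" using ge[of i j'] i that by auto
      also have "\<dots> \<le> (\<Sum>j'\<in>{..<s} - {j}. z i j')"
        using that z0 i by (intro member_le_sum) auto
      finally show False using row ge[OF i j] False \<alpha> by linarith
    qed
    then show ?thesis using row by simp
  qed simp
  define n where "n = card {i \<in> {..<m}. z i 0 \<noteq> 0}"
  have "(\<Sum>i<m. z i 0) = (\<Sum>i<m. if z i 0 \<noteq> 0 then 1 else 0)" using one[OF _ s] by (intro sum.cong) auto
  also have "\<dots> = real n" by (simp add: n_def sum.If_cases Int_def)
  finally have "real n = real m / real s" using z s by (simp add: share_matrix_def)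
  then have "real m = real (n * s)" using s by (simp add: field_simps)
  then have "m = n * s" by (simp only: of_nat_eq_iff)
  then show ?thesis by simp
qed

text \<open>A whole muffin given to one student counts as two pieces.\<close>
lemma share_matrix_feasible:
  assumes z: "share_matrix m s \<alpha> z" and \<alpha>: "1 / 3 < \<alpha>" "\<alpha> \<le> 1 / 2"
  shows "feasible m (1 - 2 * \<alpha>) 2 s (2 * m) (real m / real s) \<alpha> 0 1"
proof -
  have ge: "z i j = 0 \<or> \<alpha> \<le> z i j" if "i < m" "j < s" for i j
    using z that unfolding share_matrix_def by blast
  have z0: "0 \<le> z i j" if "i < m" "j < s" for i j using ge[OF that] \<alpha> by auto
  have row: "(\<Sum>j<s. z i j) = 1" if "i < m" for i using z that by (simp add: share_matrix_def)
  have col: "(\<Sum>i<m. z i j) = real m / real s" if "j < s" for j using z that by (simp add: share_matrix_def)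
  define w :: "nat \<Rightarrow> nat \<Rightarrow> nat" where "w = (\<lambda>i j. if z i j = 0 then 0 else if z i j = 1 then 2 else 1)"
  define y where "y = (\<lambda>i j. z i j - \<alpha> * w i j)"
  have y0: "0 \<le> y i j" if "i < m" "j < s" for i j using ge[OF that] \<alpha> by (auto simp: y_def w_def)
  have supp: "y i j \<noteq> 0 \<Longrightarrow> z i j \<noteq> 0" for i j by (auto simp: y_def w_def)
  \<comment> \<open>Three shares above 1/3 would exceed 1. So there is a single share 1, counted
    twice, or two smaller shares, counted once each.\<close>
  have rows: "(\<Sum>j<s. w i j) = 2 \<and> card {j \<in> {..<s}. z i j \<noteq> 0} \<le> 2" if i: "i < m" for i
  proof -
    define B where "B = {j \<in> {..<s}. z i j \<noteq> 0}"
    have fB: "finite B" by (simp add: B_def)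
    have "(\<Sum>j\<in>B. z i j) = (\<Sum>j<s. z i j)"
      by (rule sum.mono_neutral_left) (auto simp: B_def)
    then have sB: "(\<Sum>j\<in>B. z i j) = 1" using row[OF i] by simp
    have wB: "(\<Sum>j<s. w i j) = (\<Sum>j\<in>B. w i j)"
      by (rule sum.mono_neutral_right) (auto simp: B_def w_def)
    have B\<alpha>: "\<alpha> \<le> z i j" if "j \<in> B" for j using ge[OF i, of j] that by (auto simp: B_def)
    have "real (card B) * \<alpha> \<le> 1" using sum_bounded_below[of B \<alpha> "z i"] B\<alpha> sB by simp
    then have c2: "card B \<le> 2"
    proof (rule contrapos_pp)
      assume "\<not> card B \<le> 2"
      then have "3 * \<alpha> \<le> real (card B) * \<alpha>" using \<alpha> by (intro mult_right_mono) auto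
      then show "\<not> real (card B) * \<alpha> \<le> 1" using \<alpha> by linarith
    qed
    moreover have "card B \<noteq> 0" using sB fB by auto
    ultimately consider "card B = 1" | "card B = 2" by linarith
    then have "(\<Sum>j\<in>B. w i j) = 2"
    proof cases
      case 1
      then obtain j where "B = {j}" by (auto simp: card_1_singleton_iff)
      then show ?thesis using sB by (simp add: w_def)
    next
      case 2
      then obtain j j' where B: "B = {j, j'}" "j \<noteq> j'" by (auto simp: card_2_iff)
      have "z i j + z i j' = 1" using sB B by simp
      moreover have "\<alpha> \<le> z i j" "\<alpha> \<le> z i j'" using B\<alpha> B by auto
      ultimately show ?thesis using B \<alpha> by (auto simp: w_def)
    qed
    then show ?thesis using wB c2 by (simp add: B_def)
  qed
  define \<tau> where "\<tau> = (\<lambda>j. \<Sum>i<m. w i j)"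
  have "(\<Sum>j<s. \<tau> j) = (\<Sum>i<m. \<Sum>j<s. w i j)" unfolding \<tau>_def by (rule sum.swap)
  then have "(\<Sum>j<s. \<tau> j) = 2 * m" using rows by simp
  moreover have "transport {..<m} (\<lambda>_. 1 - 2 * \<alpha>) (\<lambda>_. 2) {..<s} (\<lambda>j. real m / real s - real (\<tau> j) * \<alpha>)
      (\<lambda>j. 0 + \<tau> j * 1) y"
    unfolding transport_def
  proof (intro conjI ballI)
    fix i assume i: "i \<in> {..<m}"
    have "(\<Sum>j<s. y i j) = (\<Sum>j<s. z i j) - \<alpha> * real (\<Sum>j<s. w i j)"
      by (simp add: y_def sum_subtractf sum_distrib_left)
    moreover have "(\<Sum>j<s. w i j) = 2" using rows i by simp
    ultimately show "(\<Sum>j<s. y i j) = 1 - 2 * \<alpha>" using row i by (simp only: lessThan_iff)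
    have "card {j \<in> {..<s}. y i j \<noteq> 0} \<le> card {j \<in> {..<s}. z i j \<noteq> 0}"
      by (rule card_mono) (use supp in auto)
    then show "card {j \<in> {..<s}. y i j \<noteq> 0} \<le> 2" using rows[of i] i by auto
  next
    fix j assume j: "j \<in> {..<s}"
    have "(\<Sum>i<m. y i j) = (\<Sum>i<m. z i j) - \<alpha> * real (\<tau> j)"
      by (simp add: y_def \<tau>_def sum_subtractf sum_distrib_left)
    then show "(\<Sum>i<m. y i j) = real m / real s - real (\<tau> j) * \<alpha>" using col j by simp
    have "card {i \<in> {..<m}. y i j \<noteq> 0} = (\<Sum>i<m. if y i j \<noteq> 0 then 1 else 0)"
      by (simp add: sum.If_cases Int_def)
    also have "\<dots> \<le> \<tau> j" unfolding \<tau>_def by (intro sum_mono) (use supp in \<open>auto simp: w_def\<close>)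
    finally show "card {i \<in> {..<m}. y i j \<noteq> 0} \<le> 0 + \<tau> j * 1" by simp
  qed (use y0 in auto)
  ultimately show ?thesis unfolding feasible_def by blast
qed

text \<open>The completed multigraph tells how many pieces go where, and giving
  \<open>\<alpha>\<close> back to each piece undoes the subtraction. Two parallel edges merge into
  one share of at least \<open>2 * \<alpha>\<close>.\<close>

lemma feasible_share_matrix:
  assumes f: "feasible m (1 - 2 * \<alpha>) 2 s (2 * m) (real m / real s) \<alpha> 0 1" and \<alpha>: "0 < \<alpha>"
  shows "\<exists>z. share_matrix m s \<alpha> z"
proof -
  obtain \<tau> y where \<tau>: "(\<Sum>j<s. \<tau> j) = 2 * m" and
    y: "transport {..<m} (\<lambda>_. 1 - 2 * \<alpha>) (\<lambda>_. 2) {..<s} (\<lambda>j. real m / real s - real (\<tau> j) * \<alpha>)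
      (\<lambda>j. 0 + \<tau> j * 1) y"
    using f unfolding feasible_def by blast
  have "(\<Sum>i<m. 2) = (\<Sum>j<s. 0 + \<tau> j * 1)" using \<tau> by simp
  from transport_multiplicities[OF _ _ y this] obtain n :: "nat \<Rightarrow> nat \<Rightarrow> nat" where
    n: "\<forall>i\<in>{..<m}. (\<Sum>j<s. n i j) = 2" "\<forall>j\<in>{..<s}. (\<Sum>i<m. n i j) = 0 + \<tau> j * 1"
    "\<forall>i\<in>{..<m}. \<forall>j\<in>{..<s}. y i j \<noteq> 0 \<longrightarrow> n i j \<noteq> 0" by auto
  define z where "z = (\<lambda>i j. y i j + \<alpha> * n i j)"
  have "share_matrix m s \<alpha> z"
    unfolding share_matrix_def
  proof (intro conjI allI impI)
    fix i j assume ij: "i < m" "j < s"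
    then have y0: "0 \<le> y i j" using y by (auto simp: transport_def)
    show "z i j = 0 \<or> \<alpha> \<le> z i j"
    proof (cases "n i j = 0")
      case True
      then have "y i j = 0" using n(3) ij by (metis lessThan_iff)
      then show ?thesis using True by (simp add: z_def)
    next
      case False
      then have "\<alpha> * 1 \<le> \<alpha> * n i j" using \<alpha> by (intro mult_left_mono) auto
      then show ?thesis using y0 by (simp add: z_def)
    qed
  next
    fix i assume i: "i < m"
    have "(\<Sum>j<s. z i j) = (\<Sum>j<s. y i j) + \<alpha> * real (\<Sum>j<s. n i j)"
      by (simp add: z_def sum.distrib sum_distrib_left)
    then show "(\<Sum>j<s. z i j) = 1" using y n(1) i by (simp add: transport_def)
  next
    fix j assume j: "j < s"
    have "(\<Sum>i<m. z i j) = (\<Sum>i<m. y i j) + \<alpha> * real (\<Sum>i<m. n i j)"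
      by (simp add: z_def sum.distrib sum_distrib_left)
    then show "(\<Sum>i<m. z i j) = real m / real s" using y n(2) j by (simp add: transport_def)
  qed
  then show ?thesis by blast
qed

lemma share_matrix_le_one:
  assumes z: "share_matrix m s \<alpha> z" and "0 < \<alpha>" "0 < m"
  shows "\<alpha> \<le> 1"
proof (rule ccontr)
  assume \<alpha>: "\<not> \<alpha> \<le> 1"
  have ge: "z 0 j = 0 \<or> \<alpha> \<le> z 0 j" if "j < s" for j using assms that by (auto simp: share_matrix_def)
  have sum1: "(\<Sum>j<s. z 0 j) = 1" using assms by (simp add: share_matrix_def)
  have "\<exists>j<s. z 0 j \<noteq> 0"
  proof (rule ccontr)
    assume "\<not> ?thesis"
    then have "(\<Sum>j<s. z 0 j) = 0" by auto
    then show False using sum1 by simp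
  qed
  then obtain j where j: "j < s" "z 0 j \<noteq> 0" by blast
  then have "\<alpha> \<le> z 0 j" using ge by blast
  also have "\<dots> \<le> (\<Sum>j<s. z 0 j)" using j ge assms(2) by (intro member_le_sum) force+
  finally show False using \<alpha> sum1 by simp
qed

text \<open>Up to 1/3 the circle construction applies; if \<open>s\<close> divides \<open>m\<close>,
  nothing needs to be cut and \<open>\<alpha> \<le> 1\<close> suffices. Otherwise
  \<open>\<alpha> \<le> 1 / 2\<close>, since larger shares would make \<open>k * s\<close> divide
  \<open>k * m\<close>, and the transport problem takes over.\<close>

lemma share_matrix_descale:
  assumes z: "share_matrix (k * m) (k * s) \<alpha> z" and k: "0 < k" and s: "0 < s" "s \<le> m" and \<alpha>: "0 < \<alpha>"
  shows "\<exists>z. share_matrix m s \<alpha> z"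
proof -
  have mono: "\<exists>z. share_matrix m s \<alpha> z" if ex: "\<exists>z. share_matrix m s \<beta> z" and le: "\<alpha> \<le> \<beta>" for \<beta>
  proof -
    obtain z where "share_matrix m s \<beta> z" using ex by blast
    then have "share_matrix m s \<alpha> z" using le by (force simp: share_matrix_def)
    then show ?thesis by blast
  qed
  consider "\<alpha> \<le> 1 / 3" | "s dvd m" | "1 / 3 < \<alpha>" "\<not> s dvd m" by linarith
  then show ?thesis
  proof cases
    case 1
    then show ?thesis using share_matrix_thirds[OF s] mono by blast
  next
    case 2
    have "\<alpha> \<le> 1" using share_matrix_le_one[OF z \<alpha>] k s by simp
    then show ?thesis using share_matrix_whole[OF s(1) 2] s mono by simp
  next
    case 3
    have half: "\<alpha> \<le> 1 / 2"
      using large_shares_whole[OF z] 3(2) k s by (force simp: not_le)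
    have fk: "feasible (k * m) (1 - 2 * \<alpha>) 2 (k * s) (k * (2 * m)) (real m / real s) \<alpha> 0 1"
      using share_matrix_feasible[OF z 3(1) half] k by (simp add: mult.left_commute)
    \<comment> \<open>Here \<open>s \<le> m\<close> enters: on average a student receives at least
      two pieces, so \<open>e \<ge> 1\<close>.\<close>
    have r: "2 \<le> 2 * m div s"
    proof -
      have "2 * s div s \<le> 2 * m div s" using s by (intro div_le_mono) simp
      then show ?thesis using s by simp
    qed
    \<comment> \<open>If the quotient is 2, then \<open>e = 1\<close> and the exceptional
      alternative holds, \<open>1 - 2 * \<alpha> < \<alpha>\<close> being
      \<open>1 / 3 < \<alpha>\<close>. Otherwise \<open>e \<ge> 2\<close>, hence
      \<open>e + 2 \<le> 2 * e\<close>.\<close>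
    have adm: "admissible 2 (0 + 2 * m div s * 1 - 1) 1 (1 - 2 * \<alpha>) \<alpha>"
    proof (cases "2 * m div s = 2")
      case True then show ?thesis using 3(1) by (simp add: admissible_def)
    next
      case False
      then have "3 \<le> 2 * m div s" using r by simp
      then obtain v where "2 * m div s = v + 3" by (metis add.commute le_Suc_ex)
      then show ?thesis by (simp add: admissible_def)
    qed
    have "feasible m (1 - 2 * \<alpha>) 2 s (2 * m) (real m / real s) \<alpha> 0 1"
      by (rule feasible_descale[OF k fk s(1) _ _ _ _ adm]) (use r \<alpha> in simp_all)
    then show ?thesis using \<alpha> by (rule feasible_share_matrix)
  qed
qed

section \<open>Passage to the supremum\<close>

lemma muffin_division_nonempty:
  assumes "muffin_division m s P" "0 < m"
  shows "P \<noteq> []"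
proof
  assume "P = []"
  then show False using assms by (auto simp: muffin_division_def)
qed

lemma smallest_piece_properties:
  assumes P: "muffin_division m s P" and m: "0 < m"
  shows "0 < smallest_piece P" and "\<exists>z. share_matrix m s (smallest_piece P) z"
proof -
  have ne: "set P \<noteq> {}" using muffin_division_nonempty[OF assms] by simp
  have "smallest_piece P \<in> (\<lambda>(i, j, x). x) ` set P"
    unfolding smallest_piece_def set_map using ne by (intro Min_in) auto
  then show "0 < smallest_piece P" using P unfolding muffin_division_def by fastforce
  have "smallest_piece P \<le> x" if "(i, j, x) \<in> set P" for i j x
    unfolding smallest_piece_def set_map using that by (intro Min_le) force+
  then show "\<exists>z. share_matrix m s (smallest_piece P) z" using division_share_matrix[OF P] by blast
qed

lemma le_smallest_piece:
  assumes "share_matrix m s \<alpha> z" "0 < \<alpha>" "0 < m"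
  shows "\<exists>P. muffin_division m s P \<and> \<alpha> \<le> smallest_piece P"
proof -
  obtain P where P: "muffin_division m s P" "\<forall>(i, j, x)\<in>set P. \<alpha> \<le> x"
    using share_matrix_division[OF assms(1,2)] by blast
  have "set P \<noteq> {}" using muffin_division_nonempty[OF P(1) assms(3)] by simp
  then have "\<alpha> \<le> smallest_piece P"
    unfolding smallest_piece_def set_map using P(2) by (subst Min_ge_iff) auto
  then show ?thesis using P by blast
qed

text \<open>Thresholds are transferred one by one, so the suprema compare without knowing that they
  are attained. The matrix for 1/3 makes the set nonempty, and the bound 1 makes the supremum
  meaningful.\<close>

lemma muffin_f_mono:
  assumes "0 < m" "0 < m'" and ex: "\<exists>z. share_matrix m s (1 / 3) z"
    and im: "\<And>\<alpha> z. 0 < \<alpha> \<Longrightarrow> share_matrix m s \<alpha> z \<Longrightarrow> \<exists>z. share_matrix m' s' \<alpha> z"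
  shows "muffin_f m s \<le> muffin_f m' s'"
  unfolding muffin_f_def
proof (rule cSup_mono)
  show "{smallest_piece P |P. muffin_division m s P} \<noteq> {}"
    using ex le_smallest_piece[of m s "1 / 3"] assms(1) by auto
  show "bdd_above {smallest_piece P |P. muffin_division m' s' P}"
  proof (rule bdd_aboveI[of _ 1])
    fix b assume "b \<in> {smallest_piece P |P. muffin_division m' s' P}"
    then obtain P where P: "muffin_division m' s' P" "b = smallest_piece P" by blast
    obtain z where "share_matrix m' s' b z"
      using smallest_piece_properties(2)[OF P(1) assms(2)] P(2) by blast
    then show "b \<le> 1"
      by (rule share_matrix_le_one) (use smallest_piece_properties(1)[OF P(1) assms(2)] P(2) assms(2) in auto)
  qed
  fix b assume "b \<in> {smallest_piece P |P. muffin_division m s P}"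
  then obtain P where P: "muffin_division m s P" "b = smallest_piece P" by blast
  have b: "0 < b" using smallest_piece_properties(1)[OF P(1) assms(1)] P(2) by simp
  obtain z where "share_matrix m s b z"
    using smallest_piece_properties(2)[OF P(1) assms(1)] P(2) by blast
  from im[OF b this] obtain z' where "share_matrix m' s' b z'" by blast
  from le_smallest_piece[OF this b assms(2)] obtain P' where
    "muffin_division m' s' P'" "b \<le> smallest_piece P'" by blast
  then show "\<exists>a\<in>{smallest_piece P |P. muffin_division m' s' P}. b \<le> a" by blast
qed

theorem theorem16:
  fixes k m s :: nat
  assumes "k \<ge> 2" and "s \<ge> 1" and "m \<ge> s"
  shows "muffin_f (k * m) (k * s) = muffin_f m s"
proof (rule antisym)
  have pos: "0 < k" "0 < s" "0 < m" "0 < k * m" using assms by auto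
  have thirds: "\<exists>z. share_matrix m s (1 / 3) z" using share_matrix_thirds assms(3) pos(2) by blast
  have copies: "\<exists>z. share_matrix (k * m) (k * s) \<alpha> z" if "share_matrix m s \<alpha> z" for \<alpha> z
    using share_matrix_copies[OF that pos(1-3)] .
  have thirds': "\<exists>z. share_matrix (k * m) (k * s) (1 / 3) z" using thirds copies by blast
  show "muffin_f (k * m) (k * s) \<le> muffin_f m s"
    by (rule muffin_f_mono[OF pos(4,3) thirds'])
      (rule share_matrix_descale[OF _ pos(1,2) assms(3)])
  show "muffin_f m s \<le> muffin_f (k * m) (k * s)"
    by (rule muffin_f_mono[OF pos(3,4) thirds]) (rule copies)
qed

end
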